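(* Let $\mathcal C$ have a terminal object $1$ and be strictly connected, and let the class $\mathcal S$ contain the morphisms $!_A:A\to 1$, for all objects $A$ that are not strict initial. Then all hom-sets of $\mathsf{Sect}(\mathcal C,\mathcal S)$ contain only either one or two morphisms; they are all singletons when $\mathcal C$ has no strict initial object, in which case $\mathsf{Sect}(\mathcal C,\mathcal S)$ is equivalent to the terminal category $\mathsf 1$.
   Context: Standing assumptions: $\mathcal C$ is a category and $\mathcal S$ is a class of morphisms of $\mathcal C$ that contains all isomorphisms, is closed under composition, and is such that pullbacks of $\mathcal S$-morphisms along arbitrary morphisms exist in $\mathcal C$ and belong to $\mathcal S$. An initial object $0$ is strict initial if every morphism $C\to 0$ is an isomorphism. $\mathcal C$ is strictly connected if for all objects $A$ the hom-functor $\mathcal C(A,-):\mathcal C\to\mathsf{Set}$ reflects strict initial objects; that is, for all objects $A,B$, the hom-set $\mathcal C(A,B)$ may be empty only if $B$ is strict initial in $\mathcal C$. (Existence of a strict initial object is not assumed.) $\mathcal S$-spans: an $\mathcal S$-span $(s,f):A\to B$ is a pair $s:D\to A$ in $\mathcal S$, $f:D\to B$ in $\mathcal C$. A (vertical) morphism $x:(s,f)\to(\tilde s,\tilde f)$ is a $\mathcal C$-morphism with $\tilde s\cdot x=s$, $\tilde f\cdot x=f$. Isomorphic $\mathcal S$-spans are identified. $\mathsf{Span}(\mathcal C,\mathcal S)$ is the category with the objects of $\mathcal C$ and (isomorphism classes of) $\mathcal S$-spans as morphisms, with (horizontal) composition $(t,g)\cdot(s,f)=(s\cdot t',g\cdot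 f')$, where $f\cdot t'=t\cdot f'$ is a pullback square. A relation for $\mathcal S$-spans is compatible if it relates only $\mathcal S$-spans with the same domain and codomain, relates vertically isomorphic $\mathcal S$-spans, and is preserved by horizontal composition from either side. An $\mathcal S$-cospan $\langle f,s\rangle:A\to B$ is (the isomorphism class of) a pair $f:A\to D$ in $\mathcal C$, $s:B\to D$ in $\mathcal S$; write $\langle f,s\rangle\preceq\langle g,t\rangle$ iff there is $v\in\mathcal S$ with $v\cdot f=g$, $v\cdot s=t$. $\mathrm{pb}\langle f,s\rangle:=(s',f')$ is the $\mathcal S$-span given by the pullback square $f\cdot s'=s\cdot f'$. $\approx_{\mathrm a}$ is the least compatible relation for $\mathcal S$-spans such that $\langle f,s\rangle\preceq\langle g,t\rangle$ implies $\mathrm{pb}\langle f,s\rangle\approx_{\mathrm a}\mathrm{pb}\langle g,t\rangle$; $\sim_{\mathrm a}$ is the equivalence relation generated by it (it is compatible), and $\mathsf{Sect}(\mathcal C,\mathcal S)$ is the quotient category of $\mathsf{Span}(\mathcal C,\mathcal S)$ by $\sim_{\mathrm a}$.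
   Formalization: The hom-set from A to B has one or two morphisms except when B is strict initial and no morphism B→A lies in S; then it is empty, so the claim as printed fails (e.g. C the poset 0<1, S the identities, hom-set from 1 to 0). *)

theory Defs
  imports Main
begin

section \<open>Categories\<close>

record ('o, 'm) cat =
  obj  :: "'o set"
  arr  :: "'m set"
  cdom :: "'m \<Rightarrow> 'o"
  ccod :: "'m \<Rightarrow> 'o"
  cid  :: "'o \<Rightarrow> 'm"
  comp :: "'m \<Rightarrow> 'm \<Rightarrow> 'm"  (infixl "\<cdot>\<index>" 70)

definition hom :: "('o, 'm) cat \<Rightarrow> 'o \<Rightarrow> 'o \<Rightarrow> 'm set" where
  "hom C A B = {f \<in> arr C. cdom C f = A \<and> ccod C f = B}"

text \<open>\<open>g \<cdot>\<^bsub>C\<^esub> f\<close> is ``first \<open>f\<close>, then \<open>g\<close>''; it is unconstrained when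
  \<open>f\<close> and \<open>g\<close> are not composable.\<close>

locale category =
  fixes C :: "('o, 'm) cat" (structure)
  assumes dom_obj: "f \<in> arr C \<Longrightarrow> cdom C f \<in> obj C"
    and cod_obj: "f \<in> arr C \<Longrightarrow> ccod C f \<in> obj C"
    and id_hom: "A \<in> obj C \<Longrightarrow> cid C A \<in> hom C A A"
    and comp_hom: "\<lbrakk>f \<in> hom C X Y; g \<in> hom C Y Z\<rbrakk> \<Longrightarrow> g \<cdot> f \<in> hom C X Z"
    and comp_id_right: "f \<in> hom C X Y \<Longrightarrow> f \<cdot> cid C X = f"
    and comp_id_left: "f \<in> hom C X Y \<Longrightarrow> cid C Y \<cdot> f = f"
    and comp_assoc: "\<lbrakk>f \<in> hom C W X; g \<in> hom C X Y; h \<in> hom C Y Z\<rbrakk>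
      \<Longrightarrow> (h \<cdot> g) \<cdot> f = h \<cdot> (g \<cdot> f)"

definition iso :: "('o, 'm) cat \<Rightarrow> 'm \<Rightarrow> bool" where
  "iso C f \<longleftrightarrow> f \<in> arr C \<and> (\<exists>g \<in> hom C (ccod C f) (cdom C f).
     comp C g f = cid C (cdom C f) \<and> comp C f g = cid C (ccod C f))"

definition terminal_obj :: "('o, 'm) cat \<Rightarrow> 'o \<Rightarrow> bool" where
  "terminal_obj C T \<longleftrightarrow> T \<in> obj C \<and> (\<forall>A \<in> obj C. \<exists>!f. f \<in> hom C A T)"

definition initial_obj :: "('o, 'm) cat \<Rightarrow> 'o \<Rightarrow> bool" where
  "initial_obj C Z \<longleftrightarrow> Z \<in> obj C \<and> (\<forall>A \<in> obj C. \<exists>!f. f \<in> hom C Z A)"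

definition strict_initial :: "('o, 'm) cat \<Rightarrow> 'o \<Rightarrow> bool" where
  "strict_initial C Z \<longleftrightarrow>
     initial_obj C Z \<and> (\<forall>A \<in> obj C. \<forall>f \<in> hom C A Z. iso C f)"

definition strictly_connected :: "('o, 'm) cat \<Rightarrow> bool" where
  "strictly_connected C \<longleftrightarrow>
     (\<forall>A \<in> obj C. \<forall>B \<in> obj C. hom C A B = {} \<longrightarrow> strict_initial C B)"

text \<open>\<open>is_pullback C f s s' f'\<close>: the square \<open>f \<cdot> s' = s \<cdot> f'\<close> is a pullback,
  so \<open>s'\<close> is a pullback of \<open>s\<close> along \<open>f\<close>.\<close>

definition is_pullback :: "('o, 'm) cat \<Rightarrow> 'm \<Rightarrow> 'm \<Rightarrow> 'm \<Rightarrow> 'm \<Rightarrow> bool" where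
  "is_pullback C f s s' f' \<longleftrightarrow>
     f \<in> arr C \<and> s \<in> arr C \<and> s' \<in> arr C \<and> f' \<in> arr C \<and>
     ccod C f = ccod C s \<and> ccod C s' = cdom C f \<and> ccod C f' = cdom C s \<and>
     cdom C s' = cdom C f' \<and> comp C f s' = comp C s f' \<and>
     (\<forall>X \<in> obj C. \<forall>u \<in> hom C X (cdom C f). \<forall>v \<in> hom C X (cdom C s).
        comp C f u = comp C s v \<longrightarrow>
        (\<exists>!w. w \<in> hom C X (cdom C s') \<and> comp C s' w = u \<and> comp C f' w = v))"


section \<open>Functors and equivalence of categories\<close>

definition is_functor ::
  "('o, 'm) cat \<Rightarrow> ('p, 'n) cat \<Rightarrow> ('o \<Rightarrow> 'p) \<Rightarrow> ('m \<Rightarrow> 'n) \<Rightarrow> bool" where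
  "is_functor C D Fo Fa \<longleftrightarrow>
     (\<forall>A \<in> obj C. Fo A \<in> obj D) \<and>
     (\<forall>f \<in> arr C. Fa f \<in> hom D (Fo (cdom C f)) (Fo (ccod C f))) \<and>
     (\<forall>A \<in> obj C. Fa (cid C A) = cid D (Fo A)) \<and>
     (\<forall>f \<in> arr C. \<forall>g \<in> arr C. ccod C f = cdom C g \<longrightarrow>
        Fa (comp C g f) = comp D (Fa g) (Fa f))"

definition natural_iso ::
  "('o, 'm) cat \<Rightarrow> ('p, 'n) cat \<Rightarrow> ('o \<Rightarrow> 'p) \<Rightarrow> ('m \<Rightarrow> 'n) \<Rightarrow> ('o \<Rightarrow> 'p) \<Rightarrow> ('m \<Rightarrow> 'n)
     \<Rightarrow> ('o \<Rightarrow> 'n) \<Rightarrow> bool" where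
  "natural_iso C D Fo Fa Go Ga \<eta> \<longleftrightarrow>
     (\<forall>A \<in> obj C. \<eta> A \<in> hom D (Fo A) (Go A) \<and> iso D (\<eta> A)) \<and>
     (\<forall>f \<in> arr C. comp D (Ga f) (\<eta> (cdom C f)) = comp D (\<eta> (ccod C f)) (Fa f))"

definition equivalent_cats :: "('o, 'm) cat \<Rightarrow> ('p, 'n) cat \<Rightarrow> bool" where
  "equivalent_cats C D \<longleftrightarrow> category C \<and> category D \<and>
     (\<exists>Fo Fa Go Ga \<eta> \<epsilon>. is_functor C D Fo Fa \<and> is_functor D C Go Ga \<and>
        natural_iso C C (\<lambda>A. A) (\<lambda>f. f) (\<lambda>A. Go (Fo A)) (\<lambda>f. Ga (Fa f)) \<eta> \<and>
        natural_iso D D (\<lambda>B. Fo (Go B)) (\<lambda>g. Fa (Ga g)) (\<lambda>B. B) (\<lambda>g. g) \<epsilon>)"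

definition terminal_cat :: "(unit, unit) cat" where
  "terminal_cat = \<lparr>obj = {()}, arr = {()}, cdom = (\<lambda>_. ()), ccod = (\<lambda>_. ()),
     cid = (\<lambda>_. ()), comp = (\<lambda>_ _. ())\<rparr>"


section \<open>Quotient categories\<close>

text \<open>Intended for an equivalence relation \<open>R\<close> on \<open>arr K\<close> that relates only parallel
  arrows and is preserved by composition.\<close>

definition quotient_cat :: "('o, 'm) cat \<Rightarrow> ('m \<times> 'm) set \<Rightarrow> ('o, 'm set) cat" where
  "quotient_cat K R =
     \<lparr>obj = obj K,
      arr = arr K // R,
      cdom = (\<lambda>X. the_elem (cdom K ` X)),
      ccod = (\<lambda>X. the_elem (ccod K ` X)),
      cid = (\<lambda>A. R `` {cid K A}),
      comp = (\<lambda>Y X. \<Union>y \<in> Y. \<Union>x \<in> X. R `` {comp K y x})\<rparr>"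


section \<open>Spans\<close>

locale stable_class = category C
  for C :: "('o, 'm) cat" (structure) +
  fixes S :: "'m set"
  assumes S_arr: "S \<subseteq> arr C"
    and S_iso: "iso C f \<Longrightarrow> f \<in> S"
    and S_comp: "\<lbrakk>s \<in> S; t \<in> S; ccod C s = cdom C t\<rbrakk> \<Longrightarrow> t \<cdot> s \<in> S"
    and S_pullback_ex: "\<lbrakk>s \<in> S; f \<in> arr C; ccod C f = ccod C s\<rbrakk>
      \<Longrightarrow> \<exists>s' f'. is_pullback C f s s' f'"
    and S_pullback: "\<lbrakk>s \<in> S; is_pullback C f s s' f'\<rbrakk> \<Longrightarrow> s' \<in> S"

text \<open>A span \<open>(s, f)\<close> goes from \<open>ccod C s\<close> to \<open>ccod C f\<close>.\<close>

definition spans :: "('o, 'm) cat \<Rightarrow> 'm set \<Rightarrow> ('m \<times> 'm) set" where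
  "spans C S = {(s, f). s \<in> S \<and> f \<in> arr C \<and> cdom C s = cdom C f}"

definition span_dom :: "('o, 'm) cat \<Rightarrow> 'm \<times> 'm \<Rightarrow> 'o" where
  "span_dom C p = ccod C (fst p)"

definition span_cod :: "('o, 'm) cat \<Rightarrow> 'm \<times> 'm \<Rightarrow> 'o" where
  "span_cod C p = ccod C (snd p)"

definition span_iso :: "('o, 'm) cat \<Rightarrow> 'm set \<Rightarrow> (('m \<times> 'm) \<times> ('m \<times> 'm)) set" where
  "span_iso C S = {((s, f), (s2, f2)). (s, f) \<in> spans C S \<and> (s2, f2) \<in> spans C S \<and>
     (\<exists>x \<in> hom C (cdom C s) (cdom C s2). iso C x \<and> comp C s2 x = s \<and> comp C f2 x = f)}"

text \<open>\<open>span_comp C q p c\<close>: \<open>c\<close> is a composite \<open>q \<cdot> p\<close> (first \<open>p\<close>, then \<open>q\<close>), computed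
  with any choice of pullback; the composite is thus determined up to isomorphism of spans.\<close>

definition span_comp ::
  "('o, 'm) cat \<Rightarrow> 'm \<times> 'm \<Rightarrow> 'm \<times> 'm \<Rightarrow> 'm \<times> 'm \<Rightarrow> bool" where
  "span_comp C q p c \<longleftrightarrow> (case q of (t, g) \<Rightarrow> case p of (s, f) \<Rightarrow>
     \<exists>t' f'. is_pullback C f t t' f' \<and> c = (comp C s t', comp C g f'))"

definition Span :: "('o, 'm) cat \<Rightarrow> 'm set \<Rightarrow> ('o, ('m \<times> 'm) set) cat" where
  "Span C S =
     \<lparr>obj = obj C,
      arr = spans C S // span_iso C S,
      cdom = (\<lambda>X. the_elem (span_dom C ` X)),
      ccod = (\<lambda>X. the_elem (span_cod C ` X)),
      cid = (\<lambda>A. span_iso C S `` {(cid C A, cid C A)}),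
      comp = (\<lambda>Y X. {c. \<exists>q \<in> Y. \<exists>p \<in> X. span_comp C q p c})\<rparr>"

text \<open>Since all choices of composites are related, a compatible relation is also closed under
  replacing either span by an isomorphic one (compose with identity spans).\<close>

definition compatible ::
  "('o, 'm) cat \<Rightarrow> 'm set \<Rightarrow> (('m \<times> 'm) \<times> ('m \<times> 'm)) set \<Rightarrow> bool" where
  "compatible C S R \<longleftrightarrow>
     (\<forall>(p, q) \<in> R. p \<in> spans C S \<and> q \<in> spans C S \<and>
        span_dom C p = span_dom C q \<and> span_cod C p = span_cod C q) \<and>
     span_iso C S \<subseteq> R \<and>
     (\<forall>(p, q) \<in> R. \<forall>r \<in> spans C S. \<forall>c d.
        span_comp C r p c \<and> span_comp C r q d \<longrightarrow> (c, d) \<in> R) \<and>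
     (\<forall>(p, q) \<in> R. \<forall>r \<in> spans C S. \<forall>c d.
        span_comp C p r c \<and> span_comp C q r d \<longrightarrow> (c, d) \<in> R)"


section \<open>Cospans and the category \<open>Sect\<close>\<close>

definition cospans :: "('o, 'm) cat \<Rightarrow> 'm set \<Rightarrow> ('m \<times> 'm) set" where
  "cospans C S = {(f, s). f \<in> arr C \<and> s \<in> S \<and> ccod C f = ccod C s}"

definition cospan_le ::
  "('o, 'm) cat \<Rightarrow> 'm set \<Rightarrow> 'm \<times> 'm \<Rightarrow> 'm \<times> 'm \<Rightarrow> bool" where
  "cospan_le C S a b \<longleftrightarrow> (case a of (f, s) \<Rightarrow> case b of (g, t) \<Rightarrow>
     \<exists>v \<in> S. cdom C v = ccod C s \<and> ccod C v = ccod C t \<and>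
       comp C v f = g \<and> comp C v s = t)"

definition is_pb :: "('o, 'm) cat \<Rightarrow> 'm \<times> 'm \<Rightarrow> 'm \<times> 'm \<Rightarrow> bool" where
  "is_pb C a p \<longleftrightarrow> (case a of (f, s) \<Rightarrow> case p of (s', f') \<Rightarrow> is_pullback C f s s' f')"

definition approx_a ::
  "('o, 'm) cat \<Rightarrow> 'm set \<Rightarrow> (('m \<times> 'm) \<times> ('m \<times> 'm)) set" where
  "approx_a C S = \<Inter>{R. compatible C S R \<and>
     (\<forall>a \<in> cospans C S. \<forall>b \<in> cospans C S. \<forall>p q.
        cospan_le C S a b \<and> is_pb C a p \<and> is_pb C b q \<longrightarrow> (p, q) \<in> R)}"

definition sim_a ::
  "('o, 'm) cat \<Rightarrow> 'm set \<Rightarrow> (('m \<times> 'm) \<times> ('m \<times> 'm)) set" where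
  "sim_a C S = \<Inter>{E. equiv (spans C S) E \<and> approx_a C S \<subseteq> E}"

text \<open>The relation that \<open>sim_a\<close> induces on isomorphism classes of spans.\<close>

definition sim_a_classes ::
  "('o, 'm) cat \<Rightarrow> 'm set \<Rightarrow> (('m \<times> 'm) set \<times> ('m \<times> 'm) set) set" where
  "sim_a_classes C S = {(X, Y). X \<in> arr (Span C S) \<and> Y \<in> arr (Span C S) \<and>
     (\<exists>p \<in> X. \<exists>q \<in> Y. (p, q) \<in> sim_a C S)}"

definition Sect :: "('o, 'm) cat \<Rightarrow> 'm set \<Rightarrow> ('o, ('m \<times> 'm) set set) cat" where
  "Sect C S = quotient_cat (Span C S) (sim_a_classes C S)"

end

theory Submission
  imports Defs
begin

text \<open>
  A span whose apex is strict initial is determined up to isomorphism by its domain and codomain.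
  All other parallel spans are equivalent. Indeed, if \<open>Y\<close> is not strict initial, then any two arrows
  \<open>f, f': X \<rightarrow> Y\<close> have equivalent graphs \<open>(1, f)\<close> and \<open>(1, f')\<close>, since \<open>\<langle>f, 1\<rangle> \<preceq> \<langle>!, !\<rangle>\<close>. For a span
  \<open>(s, f): A \<rightarrow> B\<close> with apex \<open>D\<close> that is not strict initial, there is an arrow \<open>h: A \<rightarrow> D\<close> by strict
  connectedness, and \<open>\<langle>h, 1\<rangle> \<preceq> \<langle>s \<cdot> h, s\<rangle>\<close> makes \<open>(s, f)\<close> equivalent to the graph of \<open>f \<cdot> h\<close>.
\<close>

section \<open>Isomorphisms and pullbacks\<close>

text \<open>The arrow \<open>h\<close> supplied by connectedness need not be a section of
  \<open>s\<close>. The missing equation \<open>s \<cdot> h = 1\<close> is replaced by an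
  equivalence: \<open>A\<close> receives an arrow from \<open>D\<close>, so it is not strict initial
  either, and the first observation, applied to the parallel arrows \<open>s \<cdot> h\<close> and
  \<open>1\<close> on \<open>A\<close>, makes their graphs equivalent.

  This bounds every hom-set by two classes, but does not make it inhabited. For sets with the
  surjections as \<open>S\<close>, a span from the one-element set to the empty set would have the
  empty set as apex and a surjection from it onto the one-element set, so there is none. Hence the
  theorem separates the case in which the codomain is strict initial and has no arrow in
  \<open>S\<close> to the domain.

  Since \<open>Sect\<close> is a quotient of a quotient, with composition defined by unions over
  representatives, its equality, domains and composites have to be traced back to single spans
  before the argument applies.\<close>

context category
begin

lemma arr_hom: "f \<in> arr C \<Longrightarrow> f \<in> hom C (cdom C f) (ccod C f)"
  by (simp add: hom_def)

lemma homD: "f \<in> hom C A B \<Longrightarrow> f \<in> arr C \<and> cdom C f = A \<and> ccod C f = B \<and> A \<in> obj C \<and> B \<in> obj C"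
  using dom_obj cod_obj by (auto simp: hom_def)

lemma isoE:
  assumes "iso C x" "x \<in> hom C A B"
  obtains y where "y \<in> hom C B A" "y \<cdot> x = cid C A" "x \<cdot> y = cid C B" "iso C y"
  using assms unfolding iso_def hom_def by auto

lemma isoI:
  assumes "x \<in> hom C A B" "y \<in> hom C B A" "y \<cdot> x = cid C A" "x \<cdot> y = cid C B"
  shows "iso C x"
  using assms unfolding iso_def hom_def by auto

lemma iso_cid: "A \<in> obj C \<Longrightarrow> iso C (cid C A)"
  using id_hom comp_id_left isoI by metis

lemma iso_comp:
  assumes "iso C f" "iso C g" and f: "f \<in> hom C X Y" and g: "g \<in> hom C Y Z"
  shows "iso C (g \<cdot> f)"
proof -
  obtain f' where f': "f' \<in> hom C Y X" "f' \<cdot> f = cid C X" "f \<cdot> f' = cid C Y"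
    using isoE assms by metis
  obtain g' where g': "g' \<in> hom C Z Y" "g' \<cdot> g = cid C Y" "g \<cdot> g' = cid C Z"
    using isoE assms by metis
  show ?thesis
  proof (rule isoI)
    show "g \<cdot> f \<in> hom C X Z" "f' \<cdot> g' \<in> hom C Z X"
      using comp_hom f g f' g' by blast+
    show "(f' \<cdot> g') \<cdot> (g \<cdot> f) = cid C X"
      using comp_assoc[OF comp_hom[OF f g] g'(1) f'(1)] comp_assoc[OF f g g'(1)]
        g'(2) f'(2) comp_id_left[OF f] by simp
    show "(g \<cdot> f) \<cdot> (f' \<cdot> g') = cid C Z"
      using comp_assoc[OF comp_hom[OF g'(1) f'(1)] f g] comp_assoc[OF g'(1) f'(1) f]
        g'(3) f'(3) comp_id_left[OF g'(1)] by simp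
  qed
qed

text \<open>Strictness makes \<open>f\<close> invertible, and initiality as well as strictness are
  transported along it. Used contrapositively: if the apex of a span is not strict initial, neither
  is its domain or its codomain.\<close>

lemma strict_initial_source:
  assumes Z: "strict_initial C Z" and f: "f \<in> hom C A Z"
  shows "strict_initial C A"
proof -
  have "iso C f" using assms homD unfolding strict_initial_def by blast
  then obtain g where g: "g \<in> hom C Z A" "g \<cdot> f = cid C A" "f \<cdot> g = cid C Z" "iso C g"
    using f isoE by metis
  have "\<exists>!k. k \<in> hom C A B" if B: "B \<in> obj C" for B
  proof -
    obtain k where k: "k \<in> hom C Z B" "\<And>k'. k' \<in> hom C Z B \<Longrightarrow> k' = k"
      using Z B unfolding strict_initial_def initial_obj_def by blast
    have "l = k \<cdot> f" if l: "l \<in> hom C A B" for l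
    proof -
      have "l \<cdot> g = k" using k(2) comp_hom[OF g(1) l] by blast
      then show ?thesis using comp_assoc[OF f g(1) l] g(2) comp_id_right[OF l] by simp
    qed
    then show ?thesis using comp_hom[OF f k(1)] by blast
  qed
  moreover have "iso C k" if k: "k \<in> hom C B A" for B k
  proof -
    have "iso C (f \<cdot> k)"
      using Z comp_hom[OF k f] homD[OF k] unfolding strict_initial_def by blast
    then have "iso C (g \<cdot> (f \<cdot> k))"
      using iso_comp[OF _ g(4) comp_hom[OF k f] g(1)] by blast
    then show ?thesis
      using comp_assoc[OF k f g(1)] g(2) comp_id_left[OF k] by simp
  qed
  ultimately show ?thesis
    using homD[OF f] unfolding strict_initial_def initial_obj_def by blast
qed

text \<open>This square exhibits the graph \<open>(1, f)\<close> as the pullback of the cospan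
  \<open>\<langle>f, 1\<rangle>\<close>. It also computes composites with a graph applied last:
  \<open>(1, g)\<close> after \<open>(k, l)\<close> is \<open>(k, g \<cdot> l)\<close>.\<close>

lemma pullback_id_right:
  assumes f: "f \<in> hom C X Y"
  shows "is_pullback C f (cid C Y) (cid C X) f"
proof -
  have o: "X \<in> obj C" "Y \<in> obj C" using homD[OF f] by auto
  have "\<exists>!w. w \<in> hom C W X \<and> cid C X \<cdot> w = u \<and> f \<cdot> w = v"
    if "u \<in> hom C W X" "v \<in> hom C W Y" "f \<cdot> u = cid C Y \<cdot> v" for W u v
    by (rule ex1I[of _ u]) (use that comp_id_left[OF that(2)] comp_id_left in \<open>simp_all, metis\<close>)
  then show ?thesis
    using homD[OF f] id_hom[OF o(1), THEN homD] id_hom[OF o(2), THEN homD]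
      comp_id_left[OF f] comp_id_right[OF f]
    unfolding is_pullback_def by simp
qed

text \<open>With this choice of pullback, composing \<open>(f, g)\<close> with the identity span on
  its domain returns \<open>(f, g)\<close>.\<close>

lemma pullback_id_left:
  assumes f: "f \<in> hom C X Y"
  shows "is_pullback C (cid C Y) f f (cid C X)"
proof -
  have o: "X \<in> obj C" "Y \<in> obj C" using homD[OF f] by auto
  have "\<exists>!w. w \<in> hom C W X \<and> f \<cdot> w = u \<and> cid C X \<cdot> w = v"
    if "u \<in> hom C W Y" "v \<in> hom C W X" "cid C Y \<cdot> u = f \<cdot> v" for W u v
    by (rule ex1I[of _ v]) (use that comp_id_left[OF that(1)] comp_id_left in \<open>simp_all, metis\<close>)
  then show ?thesis
    using homD[OF f] id_hom[OF o(1), THEN homD] id_hom[OF o(2), THEN homD]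
      comp_id_left[OF f] comp_id_right[OF f]
    unfolding is_pullback_def by simp
qed

section \<open>Pullback squares and their invariance under isomorphism\<close>

lemma pullbackE:
  assumes "is_pullback C f s s' f'"
  obtains A D B P where "f \<in> hom C A D" "s \<in> hom C B D" "s' \<in> hom C P A" "f' \<in> hom C P B"
    "f \<cdot> s' = s \<cdot> f'"
    "\<forall>X u v. u \<in> hom C X A \<longrightarrow> v \<in> hom C X B \<longrightarrow> f \<cdot> u = s \<cdot> v \<longrightarrow>
       (\<exists>!w. w \<in> hom C X P \<and> s' \<cdot> w = u \<and> f' \<cdot> w = v)"
proof (rule that)
  show "f \<in> hom C (cdom C f) (ccod C f)" "s \<in> hom C (cdom C s) (ccod C f)"
    "s' \<in> hom C (cdom C s') (cdom C f)" "f' \<in> hom C (cdom C s') (cdom C s)"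
    "f \<cdot> s' = s \<cdot> f'"
    using assms unfolding is_pullback_def hom_def by auto
  show "\<forall>X u v. u \<in> hom C X (cdom C f) \<longrightarrow> v \<in> hom C X (cdom C s) \<longrightarrow> f \<cdot> u = s \<cdot> v \<longrightarrow>
       (\<exists>!w. w \<in> hom C X (cdom C s') \<and> s' \<cdot> w = u \<and> f' \<cdot> w = v)"
    using assms homD unfolding is_pullback_def by metis
qed

lemma pullbackI:
  assumes "f \<in> hom C A D" "s \<in> hom C B D" "s' \<in> hom C P A" "f' \<in> hom C P B"
    "f \<cdot> s' = s \<cdot> f'"
    and U: "\<And>X u v. u \<in> hom C X A \<Longrightarrow> v \<in> hom C X B \<Longrightarrow> f \<cdot> u = s \<cdot> v \<Longrightarrow>
       \<exists>!w. w \<in> hom C X P \<and> s' \<cdot> w = u \<and> f' \<cdot> w = v"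
  shows "is_pullback C f s s' f'"
proof -
  note h = assms(1-4)[THEN homD]
  have e: "cdom C f = A" "cdom C s = B" "cdom C s' = P" using h by auto
  show ?thesis unfolding is_pullback_def e
    using h assms(5) U by auto
qed

lemma pullback_unique:
  assumes "is_pullback C f s p q" "is_pullback C f s p' q'"
  obtains x where "x \<in> hom C (cdom C p) (cdom C p')" "iso C x" "p' \<cdot> x = p" "q' \<cdot> x = q"
proof -
  from assms(1) obtain A D B P where 1: "f \<in> hom C A D" "s \<in> hom C B D" "p \<in> hom C P A" "q \<in> hom C P B"
    "f \<cdot> p = s \<cdot> q"
    and U: "\<forall>X u v. u \<in> hom C X A \<longrightarrow> v \<in> hom C X B \<longrightarrow> f \<cdot> u = s \<cdot> v \<longrightarrow>
       (\<exists>!w. w \<in> hom C X P \<and> p \<cdot> w = u \<and> q \<cdot> w = v)"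
    by (rule pullbackE)
  note U = U[rule_format]
  from assms(2) obtain A' D' B' P' where 2: "f \<in> hom C A' D'" "s \<in> hom C B' D'" "p' \<in> hom C P' A'" "q' \<in> hom C P' B'"
    "f \<cdot> p' = s \<cdot> q'"
    and U': "\<forall>X u v. u \<in> hom C X A' \<longrightarrow> v \<in> hom C X B' \<longrightarrow> f \<cdot> u = s \<cdot> v \<longrightarrow>
       (\<exists>!w. w \<in> hom C X P' \<and> p' \<cdot> w = u \<and> q' \<cdot> w = v)"
    by (rule pullbackE)
  note U' = U'[rule_format]
  have e: "A' = A" "B' = B" using 1 2 homD by metis+
  note 2 = 2[unfolded e] and U' = U'[unfolded e]
  obtain x where x: "x \<in> hom C P P'" "p' \<cdot> x = p" "q' \<cdot> x = q"
    using U'[OF 1(3,4,5)] by blast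
  obtain y where y: "y \<in> hom C P' P" "p \<cdot> y = p'" "q \<cdot> y = q'"
    using U[OF 2(3,4,5)] by blast
  have P: "P \<in> obj C" "P' \<in> obj C" using homD x by auto
  have "p \<cdot> (y \<cdot> x) = p" "q \<cdot> (y \<cdot> x) = q"
    using x y comp_assoc[OF x(1) y(1)] 1 by metis+
  then have yx: "y \<cdot> x = cid C P"
    using U[OF 1(3,4,5)] comp_hom[OF x(1) y(1)] id_hom[OF P(1)] comp_id_right 1 by blast
  have "p' \<cdot> (x \<cdot> y) = p'" "q' \<cdot> (x \<cdot> y) = q'"
    using x y comp_assoc[OF y(1) x(1)] 2 by metis+
  then have xy: "x \<cdot> y = cid C P'"
    using U'[OF 2(3,4,5)] comp_hom[OF y(1) x(1)] id_hom[OF P(2)] comp_id_right 2 by blast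
  have "cdom C p = P" "cdom C p' = P'" using 1 2 homD by metis+
  then show thesis using that x isoI[OF x(1) y(1) yx xy] by metis
qed

text \<open>This is what allows a chosen composite of spans to be replaced by any span isomorphic to
  it.\<close>

lemma pullback_iso_apex:
  assumes "is_pullback C f s p q" and x: "x \<in> hom C W (cdom C p)" "iso C x"
  shows "is_pullback C f s (p \<cdot> x) (q \<cdot> x)"
proof -
  from assms(1) obtain A D B P where 1: "f \<in> hom C A D" "s \<in> hom C B D" "p \<in> hom C P A" "q \<in> hom C P B"
    "f \<cdot> p = s \<cdot> q"
    and U: "\<forall>X u v. u \<in> hom C X A \<longrightarrow> v \<in> hom C X B \<longrightarrow> f \<cdot> u = s \<cdot> v \<longrightarrow>
       (\<exists>!w. w \<in> hom C X P \<and> p \<cdot> w = u \<and> q \<cdot> w = v)"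
    by (rule pullbackE)
  note U = U[rule_format]
  have P: "cdom C p = P" using homD[OF 1(3)] by simp
  note x = x[unfolded P]
  obtain y where y: "y \<in> hom C P W" "y \<cdot> x = cid C W" "x \<cdot> y = cid C P"
    using isoE x by metis
  show ?thesis
  proof (rule pullbackI[OF 1(1,2) comp_hom[OF x(1) 1(3)] comp_hom[OF x(1) 1(4)]])
    show "f \<cdot> (p \<cdot> x) = s \<cdot> (q \<cdot> x)"
      using 1(5) comp_assoc[OF x(1) 1(3,1)] comp_assoc[OF x(1) 1(4,2)] by simp
    fix X u v assume uv: "u \<in> hom C X A" "v \<in> hom C X B" "f \<cdot> u = s \<cdot> v"
    obtain w where w: "w \<in> hom C X P" "p \<cdot> w = u" "q \<cdot> w = v"
      and uq: "\<And>w'. w' \<in> hom C X P \<Longrightarrow> p \<cdot> w' = u \<Longrightarrow> q \<cdot> w' = v \<Longrightarrow> w' = w"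
      using U[OF uv] by blast
    show "\<exists>!w. w \<in> hom C X W \<and> (p \<cdot> x) \<cdot> w = u \<and> (q \<cdot> x) \<cdot> w = v"
    proof (rule ex1I[where a = "y \<cdot> w"], intro conjI)
      show h: "y \<cdot> w \<in> hom C X W" using comp_hom[OF w(1) y(1)] .
      have e: "x \<cdot> (y \<cdot> w) = w"
        using comp_assoc[OF w(1) y(1) x(1)] y(3) comp_id_left[OF w(1)] by simp
      show "(p \<cdot> x) \<cdot> (y \<cdot> w) = u" "(q \<cdot> x) \<cdot> (y \<cdot> w) = v"
        using comp_assoc[OF h x(1) 1(3)] comp_assoc[OF h x(1) 1(4)] e w by simp_all
    next
      fix z assume "z \<in> hom C X W \<and> (p \<cdot> x) \<cdot> z = u \<and> (q \<cdot> x) \<cdot> z = v"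
      then have z: "z \<in> hom C X W" and "(p \<cdot> x) \<cdot> z = u" "(q \<cdot> x) \<cdot> z = v" by auto
      then have "p \<cdot> (x \<cdot> z) = u" "q \<cdot> (x \<cdot> z) = v"
        using comp_assoc[OF z x(1) 1(3)] comp_assoc[OF z x(1) 1(4)] by simp_all
      then have "x \<cdot> z = w" using uq comp_hom[OF z x(1)] by blast
      then show "z = y \<cdot> w"
        using comp_assoc[OF z x(1) y(1)] y(2) comp_id_left[OF z] by simp
    qed
  qed
qed

text \<open>When two composable spans are replaced by isomorphic ones, the legs that meet in the
  middle change by isomorphisms \<open>x\<close> and \<open>y\<close>; the projections of the
  pullback absorb these.\<close>

lemma pullback_iso_legs:
  assumes "is_pullback C (f \<cdot> x) (t \<cdot> y) p q"
    and x: "x \<in> hom C A A'" "iso C x" and y: "y \<in> hom C B B'" "iso C y"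
    and f: "f \<in> hom C A' D" and t: "t \<in> hom C B' D"
  shows "is_pullback C f t (x \<cdot> p) (y \<cdot> q)"
proof -
  have fx: "f \<cdot> x \<in> hom C A D" and ty: "t \<cdot> y \<in> hom C B D" using comp_hom x y f t by auto
  from assms(1) obtain A0 D0 B0 P where 1: "f \<cdot> x \<in> hom C A0 D0" "t \<cdot> y \<in> hom C B0 D0"
    "p \<in> hom C P A0" "q \<in> hom C P B0" "(f \<cdot> x) \<cdot> p = (t \<cdot> y) \<cdot> q"
    and U: "\<forall>X u v. u \<in> hom C X A0 \<longrightarrow> v \<in> hom C X B0 \<longrightarrow> (f \<cdot> x) \<cdot> u = (t \<cdot> y) \<cdot> v \<longrightarrow>
       (\<exists>!w. w \<in> hom C X P \<and> p \<cdot> w = u \<and> q \<cdot> w = v)"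
    by (rule pullbackE)
  note U = U[rule_format]
  have e: "A0 = A" "B0 = B" using homD fx ty 1(1,2) by metis+
  note 1 = 1[unfolded e] and U = U[unfolded e]
  obtain x' where x': "x' \<in> hom C A' A" "x' \<cdot> x = cid C A" "x \<cdot> x' = cid C A'"
    using isoE x by metis
  obtain y' where y': "y' \<in> hom C B' B" "y' \<cdot> y = cid C B" "y \<cdot> y' = cid C B'"
    using isoE y by metis
  show ?thesis
  proof (rule pullbackI[OF f t comp_hom[OF 1(3) x(1)] comp_hom[OF 1(4) y(1)]])
    show "f \<cdot> (x \<cdot> p) = t \<cdot> (y \<cdot> q)"
      using 1 comp_assoc[OF 1(3) x(1) f] comp_assoc[OF 1(4) y(1) t] by simp
    fix X u v assume u: "u \<in> hom C X A'" and v: "v \<in> hom C X B'" and uv: "f \<cdot> u = t \<cdot> v"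
    have xu: "x \<cdot> (x' \<cdot> u) = u"
      using comp_assoc[OF u x'(1) x(1)] x'(3) comp_id_left[OF u] by simp
    have yv: "y \<cdot> (y' \<cdot> v) = v"
      using comp_assoc[OF v y'(1) y(1)] y'(3) comp_id_left[OF v] by simp
    have hu: "x' \<cdot> u \<in> hom C X A" and hv: "y' \<cdot> v \<in> hom C X B"
      using comp_hom u v x' y' by blast+
    have "(f \<cdot> x) \<cdot> (x' \<cdot> u) = (t \<cdot> y) \<cdot> (y' \<cdot> v)"
      using comp_assoc[OF hu x(1) f] comp_assoc[OF hv y(1) t] xu yv uv by simp
    note ex = U[OF hu hv this]
    \<comment> \<open>As \<open>x\<close> and \<open>y\<close> are invertible, \<open>w\<close>
      mediates for the new square exactly when it mediates for the old one with the cone transported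
      along \<open>x'\<close> and \<open>y'\<close>.\<close>
    have "x \<cdot> (p \<cdot> w) = u \<longleftrightarrow> p \<cdot> w = x' \<cdot> u" "y \<cdot> (q \<cdot> w) = v \<longleftrightarrow> q \<cdot> w = y' \<cdot> v"
      if w: "w \<in> hom C X P" for w
    proof -
      have "x' \<cdot> (x \<cdot> (p \<cdot> w)) = p \<cdot> w" "y' \<cdot> (y \<cdot> (q \<cdot> w)) = q \<cdot> w"
        using comp_assoc[OF comp_hom[OF w 1(3)] x(1) x'(1)] x'(2)
          comp_assoc[OF comp_hom[OF w 1(4)] y(1) y'(1)] y'(2)
          comp_id_left[OF comp_hom[OF w 1(3)]] comp_id_left[OF comp_hom[OF w 1(4)]] by simp_all
      then show "x \<cdot> (p \<cdot> w) = u \<longleftrightarrow> p \<cdot> w = x' \<cdot> u" "y \<cdot> (q \<cdot> w) = v \<longleftrightarrow> q \<cdot> w = y' \<cdot> v"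
        using xu yv by auto
    qed
    then have "(w \<in> hom C X P \<and> (x \<cdot> p) \<cdot> w = u \<and> (y \<cdot> q) \<cdot> w = v) \<longleftrightarrow>
        (w \<in> hom C X P \<and> p \<cdot> w = x' \<cdot> u \<and> q \<cdot> w = y' \<cdot> v)" for w
      using comp_assoc[OF _ 1(3) x(1), of w X] comp_assoc[OF _ 1(4) y(1), of w X]
      by (cases "w \<in> hom C X P") simp_all
    then show "\<exists>!w. w \<in> hom C X P \<and> (x \<cdot> p) \<cdot> w = u \<and> (y \<cdot> q) \<cdot> w = v"
      using ex by simp
  qed
qed

end

section \<open>Composition and equivalence of spans\<close>

context stable_class
begin

section \<open>Spans and vertical isomorphism\<close>

lemma spansE:
  assumes "p \<in> spans C S"
  obtains s f D A B where "p = (s, f)" "s \<in> S" "s \<in> hom C D A" "f \<in> hom C D B"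
proof -
  obtain s f where "p = (s, f)" "s \<in> S" "f \<in> arr C" "cdom C s = cdom C f"
    using assms unfolding spans_def by auto
  then show thesis
    using that[of s f "cdom C s" "ccod C s" "ccod C f"] S_arr arr_hom[of s] arr_hom[of f] by auto
qed

lemma spansI: "\<lbrakk>s \<in> S; s \<in> hom C D A; f \<in> hom C D B\<rbrakk> \<Longrightarrow> (s, f) \<in> spans C S"
  unfolding spans_def hom_def by auto

lemma cid_S: "A \<in> obj C \<Longrightarrow> cid C A \<in> S"
  using S_iso iso_cid by blast

lemma span_iso_sub: "span_iso C S \<subseteq> spans C S \<times> spans C S"
  unfolding span_iso_def by auto

lemma span_isoE:
  assumes "(p, q) \<in> span_iso C S"
  obtains s f s2 f2 D D2 A B x where "p = (s, f)" "q = (s2, f2)" "s \<in> S" "s2 \<in> S"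
    "s \<in> hom C D A" "f \<in> hom C D B" "s2 \<in> hom C D2 A" "f2 \<in> hom C D2 B"
    "x \<in> hom C D D2" "iso C x" "s2 \<cdot> x = s" "f2 \<cdot> x = f"
proof -
  obtain s f s2 f2 x where pq: "p = (s, f)" "q = (s2, f2)"
    and sp: "(s, f) \<in> spans C S" "(s2, f2) \<in> spans C S"
    and x: "x \<in> hom C (cdom C s) (cdom C s2)" "iso C x" "s2 \<cdot> x = s" "f2 \<cdot> x = f"
    using assms unfolding span_iso_def by blast
  obtain D A B where 1: "s \<in> S" "s \<in> hom C D A" "f \<in> hom C D B"
    using sp(1) by (rule spansE) auto
  obtain D2 A2 B2 where 2: "s2 \<in> S" "s2 \<in> hom C D2 A2" "f2 \<in> hom C D2 B2"
    using sp(2) by (rule spansE) auto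
  have x': "x \<in> hom C D D2" using x(1) homD[OF 1(2)] homD[OF 2(2)] by simp
  \<comment> \<open>\<open>span_iso\<close> does not ask for equal ends; the two commuting triangles
    force them.\<close>
  have "A2 = A" "B2 = B"
    using comp_hom[OF x' 2(2)] comp_hom[OF x' 2(3)] x 1 homD by metis+
  then show thesis using that pq 1 2 x x' by simp
qed

lemma span_isoI:
  assumes "s \<in> S" "s2 \<in> S" "s2 \<in> hom C D2 A" "f2 \<in> hom C D2 B"
    "x \<in> hom C D D2" "iso C x" "s2 \<cdot> x = s" "f2 \<cdot> x = f"
  shows "((s, f), (s2, f2)) \<in> span_iso C S"
proof -
  have "s \<in> hom C D A" "f \<in> hom C D B" using assms comp_hom by blast+
  then show ?thesis
    using assms spansI[of s D A f B] spansI[of s2 D2 A f2 B] homD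
    unfolding span_iso_def by fastforce
qed

lemma span_iso_refl: "p \<in> spans C S \<Longrightarrow> (p, p) \<in> span_iso C S"
  using iso_cid homD id_hom comp_id_right by (metis spansE span_isoI)

lemma span_iso_sym:
  assumes "(p, q) \<in> span_iso C S"
  shows "(q, p) \<in> span_iso C S"
proof -
  from assms obtain s f s2 f2 D D2 A B x where 1: "p = (s, f)" "q = (s2, f2)" "s \<in> S" "s2 \<in> S"
    "s \<in> hom C D A" "f \<in> hom C D B" "s2 \<in> hom C D2 A" "f2 \<in> hom C D2 B"
    "x \<in> hom C D D2" "iso C x" "s2 \<cdot> x = s" "f2 \<cdot> x = f"
    by (rule span_isoE)
  obtain y where y: "y \<in> hom C D2 D" "x \<cdot> y = cid C D2" "iso C y"
    using isoE 1 by metis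
  have "s \<cdot> y = s2" "f \<cdot> y = f2"
    using comp_assoc[OF y(1) 1(9) 1(7)] comp_assoc[OF y(1) 1(9) 1(8)] y 1(11,12)
      comp_id_right[OF 1(7)] comp_id_right[OF 1(8)] by auto
  then show ?thesis using span_isoI[OF 1(4,3,5,6) y(1,3)] 1(1,2) by simp
qed

lemma span_iso_trans:
  assumes "(p, q) \<in> span_iso C S" "(q, r) \<in> span_iso C S"
  shows "(p, r) \<in> span_iso C S"
proof -
  from assms(1) obtain s f s2 f2 D D2 A B x where 1: "p = (s, f)" "q = (s2, f2)" "s \<in> S" "s2 \<in> S"
    "s \<in> hom C D A" "f \<in> hom C D B" "s2 \<in> hom C D2 A" "f2 \<in> hom C D2 B"
    "x \<in> hom C D D2" "iso C x" "s2 \<cdot> x = s" "f2 \<cdot> x = f"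
    by (rule span_isoE)
  from assms(2) obtain s2' f2' s3 f3 D2' D3 A' B' y where 2: "q = (s2', f2')" "r = (s3, f3)"
    "s2' \<in> S" "s3 \<in> S"
    "s2' \<in> hom C D2' A'" "f2' \<in> hom C D2' B'" "s3 \<in> hom C D3 A'" "f3 \<in> hom C D3 B'"
    "y \<in> hom C D2' D3" "iso C y" "s3 \<cdot> y = s2'" "f3 \<cdot> y = f2'"
    by (rule span_isoE)
  have e: "s2' = s2" "f2' = f2" "D2' = D2"
    using 1(2) 2(1) homD[OF 1(7)] homD[OF 2(5)] by auto
  note 2 = 2[unfolded e]
  have "s3 \<cdot> (y \<cdot> x) = s" "f3 \<cdot> (y \<cdot> x) = f"
    using comp_assoc[OF 1(9) 2(9) 2(7)] comp_assoc[OF 1(9) 2(9) 2(8)] 1 2 by auto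
  then show ?thesis
    using span_isoI[OF 1(3) 2(4) 2(7) 2(8) comp_hom[OF 1(9) 2(9)] iso_comp[OF 1(10) 2(10) 1(9) 2(9)]]
      1(1) 2(2) by simp
qed

lemma span_dom_simp: "s \<in> hom C D A \<Longrightarrow> span_dom C (s, f) = A"
  and span_cod_simp: "f \<in> hom C D B \<Longrightarrow> span_cod C (s, f) = B"
  unfolding span_dom_def span_cod_def hom_def by auto

lemma span_compE:
  assumes "span_comp C q p c" "q \<in> spans C S" "p \<in> spans C S"
  obtains s f t g t' f' D E P X Y Z where "p = (s, f)" "q = (t, g)" "c = (s \<cdot> t', g \<cdot> f')"
    "s \<in> S" "t \<in> S" "t' \<in> S" "s \<in> hom C D X" "f \<in> hom C D Y" "t \<in> hom C E Y" "g \<in> hom C E Z"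
    "t' \<in> hom C P D" "f' \<in> hom C P E" "is_pullback C f t t' f'"
proof -
  obtain s f D X Y where p: "p = (s, f)" "s \<in> S" "s \<in> hom C D X" "f \<in> hom C D Y"
    using assms(3) by (rule spansE)
  obtain t g E Y' Z where q: "q = (t, g)" "t \<in> S" "t \<in> hom C E Y'" "g \<in> hom C E Z"
    using assms(2) by (rule spansE)
  obtain t' f' where c: "c = (s \<cdot> t', g \<cdot> f')" and pb: "is_pullback C f t t' f'"
    using assms(1) p q unfolding span_comp_def by auto
  have "t' \<in> S" using S_pullback q pb by blast
  moreover have "Y' = Y" "t' \<in> hom C (cdom C t') D" "f' \<in> hom C (cdom C t') E"
    using pb homD[OF p(4)] homD[OF q(3)] unfolding is_pullback_def hom_def by auto
  ultimately show thesis using that[OF p(1) q(1) c p(2) q(2)] p q pb by simp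
qed

lemma span_comp_span:
  assumes "span_comp C q p c" "q \<in> spans C S" "p \<in> spans C S"
  shows "c \<in> spans C S" "span_dom C c = span_dom C p" "span_cod C c = span_cod C q"
    "span_cod C p = span_dom C q"
proof -
  from assms obtain s f t g t' f' D E P X Y Z where
    1: "p = (s, f)" "q = (t, g)" "c = (s \<cdot> t', g \<cdot> f')"
    "s \<in> S" "t \<in> S" "t' \<in> S" "s \<in> hom C D X" "f \<in> hom C D Y" "t \<in> hom C E Y" "g \<in> hom C E Z"
    "t' \<in> hom C P D" "f' \<in> hom C P E" "is_pullback C f t t' f'"
    by (rule span_compE)
  have h: "s \<cdot> t' \<in> hom C P X" "g \<cdot> f' \<in> hom C P Z" using comp_hom 1 by blast+
  have "s \<cdot> t' \<in> S" using S_comp[OF 1(6,4)] homD[OF 1(11)] homD[OF 1(7)] by simp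
  then show "c \<in> spans C S" using spansI h 1(3) by blast
  show "span_dom C c = span_dom C p" "span_cod C c = span_cod C q" "span_cod C p = span_dom C q"
    using span_dom_simp span_cod_simp h 1 by metis+
qed

lemma span_comp_ex:
  assumes "q \<in> spans C S" "p \<in> spans C S" "span_cod C p = span_dom C q"
  obtains c where "span_comp C q p c"
proof -
  obtain s f D X Y where p: "p = (s, f)" "s \<in> S" "s \<in> hom C D X" "f \<in> hom C D Y"
    using assms(2) by (rule spansE)
  obtain t g E Y' Z where q: "q = (t, g)" "t \<in> S" "t \<in> hom C E Y'" "g \<in> hom C E Z"
    using assms(1) by (rule spansE)
  have "ccod C f = ccod C t" using assms(3) p q unfolding span_dom_def span_cod_def by simp
  then obtain t' f' where "is_pullback C f t t' f'"
    using S_pullback_ex q(2) homD[OF p(4)] by metis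
  then show thesis using that p(1) q(1) unfolding span_comp_def by blast
qed

text \<open>The isomorphism is moved into the choice of the pullback. Together with
  \<open>span_comp_unique\<close> this shows that the composites of two given spans fill exactly one
  isomorphism class.\<close>

lemma span_comp_iso_result:
  assumes "span_comp C q p c" "q \<in> spans C S" "p \<in> spans C S" "(c, d) \<in> span_iso C S"
  shows "span_comp C q p d"
proof -
  from assms(1-3) obtain s f t g t' f' D E P X Y Z where
    1: "p = (s, f)" "q = (t, g)" "c = (s \<cdot> t', g \<cdot> f')"
    "s \<in> S" "t \<in> S" "t' \<in> S" "s \<in> hom C D X" "f \<in> hom C D Y" "t \<in> hom C E Y" "g \<in> hom C E Z"
    "t' \<in> hom C P D" "f' \<in> hom C P E" "is_pullback C f t t' f'"
    by (rule span_compE)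
  from span_iso_sym[OF assms(4)] obtain s3 f3 s2 f2 D3 D2 A B x where
    2: "d = (s3, f3)" "c = (s2, f2)" "s3 \<in> S" "s2 \<in> S"
    "s3 \<in> hom C D3 A" "f3 \<in> hom C D3 B" "s2 \<in> hom C D2 A" "f2 \<in> hom C D2 B"
    "x \<in> hom C D3 D2" "iso C x" "s2 \<cdot> x = s3" "f2 \<cdot> x = f3"
    by (rule span_isoE)
  have e: "s2 = s \<cdot> t'" "f2 = g \<cdot> f'" using 1(3) 2(2) by auto
  then have "D2 = P" using homD[OF 2(7)] homD[OF comp_hom[OF 1(11) 1(7)]] by simp
  then have x: "x \<in> hom C D3 P" using 2 by simp
  then have "is_pullback C f t (t' \<cdot> x) (f' \<cdot> x)"
    using pullback_iso_apex[OF 1(13)] homD[OF 1(11)] 2(10) by simp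
  moreover have "d = (s \<cdot> (t' \<cdot> x), g \<cdot> (f' \<cdot> x))"
    using comp_assoc[OF x 1(11) 1(7)] comp_assoc[OF x 1(12) 1(10)] 2(1,11,12) e by simp
  ultimately show ?thesis unfolding span_comp_def 1(1,2) by auto
qed

lemma span_comp_unique:
  assumes "span_comp C q p c" "span_comp C q p d" "q \<in> spans C S" "p \<in> spans C S"
  shows "(c, d) \<in> span_iso C S"
proof -
  from assms(1,3,4) obtain s f t g t' f' D E P X Y Z where
    1: "p = (s, f)" "q = (t, g)" "c = (s \<cdot> t', g \<cdot> f')"
    "s \<in> S" "t \<in> S" "t' \<in> S" "s \<in> hom C D X" "f \<in> hom C D Y" "t \<in> hom C E Y" "g \<in> hom C E Z"
    "t' \<in> hom C P D" "f' \<in> hom C P E" "is_pullback C f t t' f'"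
    by (rule span_compE)
  obtain t2 f2 where d: "d = (s \<cdot> t2, g \<cdot> f2)" and pb: "is_pullback C f t t2 f2"
    using assms(2) 1(1,2) unfolding span_comp_def by auto
  have h: "t2 \<in> hom C (cdom C t2) D" "f2 \<in> hom C (cdom C t2) E"
    using pb homD[OF 1(8)] homD[OF 1(9)] unfolding is_pullback_def hom_def by auto
  obtain x where "x \<in> hom C (cdom C t') (cdom C t2)" "iso C x" "t2 \<cdot> x = t'" "f2 \<cdot> x = f'"
    using pullback_unique[OF 1(13) pb] by blast
  then have x: "x \<in> hom C P (cdom C t2)" "iso C x" "t2 \<cdot> x = t'" "f2 \<cdot> x = f'"
    using homD[OF 1(11)] by simp_all
  have S: "s \<cdot> t' \<in> S" "s \<cdot> t2 \<in> S"
    using span_comp_span(1)[OF assms(1,3,4)] span_comp_span(1)[OF assms(2-4)] 1(3) d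
    unfolding spans_def by auto
  show ?thesis unfolding 1(3) d
    using span_isoI[OF S comp_hom[OF h(1) 1(7)] comp_hom[OF h(2) 1(10)] x(1,2)]
      comp_assoc[OF x(1) h(1) 1(7)] comp_assoc[OF x(1) h(2) 1(10)] x by simp
qed

text \<open>The inner legs factor as \<open>f2 \<cdot> x\<close> and \<open>t2 \<cdot> y\<close>, so
  a pullback of the old legs becomes one of \<open>f2\<close> and \<open>t2\<close> after its
  projections are composed with \<open>x\<close> and \<open>y\<close>; the outer legs of the
  composite stay the same.\<close>

lemma span_comp_iso_args:
  assumes "span_comp C q p c" "(q, q2) \<in> span_iso C S" "(p, p2) \<in> span_iso C S"
  shows "span_comp C q2 p2 c"
proof -
  from assms(3) obtain s f s2 f2 D D2 A B x where 1: "p = (s, f)" "p2 = (s2, f2)" "s \<in> S" "s2 \<in> S"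
    "s \<in> hom C D A" "f \<in> hom C D B" "s2 \<in> hom C D2 A" "f2 \<in> hom C D2 B"
    "x \<in> hom C D D2" "iso C x" "s2 \<cdot> x = s" "f2 \<cdot> x = f"
    by (rule span_isoE)
  from assms(2) obtain t g t2 g2 E E2 B' Z y where 2: "q = (t, g)" "q2 = (t2, g2)" "t \<in> S" "t2 \<in> S"
    "t \<in> hom C E B'" "g \<in> hom C E Z" "t2 \<in> hom C E2 B'" "g2 \<in> hom C E2 Z"
    "y \<in> hom C E E2" "iso C y" "t2 \<cdot> y = t" "g2 \<cdot> y = g"
    by (rule span_isoE)
  obtain t' f' where c: "c = (s \<cdot> t', g \<cdot> f')" and pb: "is_pullback C f t t' f'"
    using assms(1) 1(1) 2(1) unfolding span_comp_def by auto
  have h: "B' = B" "t' \<in> hom C (cdom C t') D" "f' \<in> hom C (cdom C t') E"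
    using pb homD[OF 1(6)] homD[OF 2(5)] unfolding is_pullback_def hom_def by auto
  have t2: "t2 \<in> hom C E2 B" using h 2 by simp
  have "is_pullback C (f2 \<cdot> x) (t2 \<cdot> y) t' f'" using pb 1 2 by simp
  then have "is_pullback C f2 t2 (x \<cdot> t') (y \<cdot> f')"
    by (rule pullback_iso_legs[OF _ 1(9,10) 2(9,10) 1(8) t2])
  moreover have "c = (s2 \<cdot> (x \<cdot> t'), g2 \<cdot> (y \<cdot> f'))"
    using c comp_assoc[OF h(2) 1(9) 1(7)] comp_assoc[OF h(3) 2(9) 2(8)] 1(11) 2(12) by simp
  ultimately show ?thesis unfolding span_comp_def 1(2) 2(2) by auto
qed

section \<open>The relations generated by cospans\<close>

definition parallel_spans where
  "parallel_spans = {(p, q). p \<in> spans C S \<and> q \<in> spans C S \<and>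
     span_dom C p = span_dom C q \<and> span_cod C p = span_cod C q}"

lemma equiv_parallel_spans: "equiv (spans C S) parallel_spans"
  unfolding parallel_spans_def by (intro equivI refl_onI symI transI) auto

lemma span_iso_parallel: "span_iso C S \<subseteq> parallel_spans"
proof clarify
  fix s f s2 f2 assume "((s, f), (s2, f2)) \<in> span_iso C S"
  then show "((s, f), (s2, f2)) \<in> parallel_spans"
    using span_iso_sub by (elim span_isoE) (auto simp: parallel_spans_def hom_def spans_def span_dom_def span_cod_def)
qed

text \<open>\<open>parallel_spans\<close> serves as an upper bound: it belongs to the families
  intersected in \<open>approx_a\<close> and in \<open>sim_a\<close>, so both relate only spans with
  the same ends.\<close>

lemma compatible_parallel_spans: "compatible C S parallel_spans"
  unfolding compatible_def
proof (intro conjI)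
  show "span_iso C S \<subseteq> parallel_spans" by (rule span_iso_parallel)
qed (auto simp: parallel_spans_def span_comp_span)

text \<open>The pullback of a cospan runs between the domains of its two legs, and composing both
  legs with \<open>v\<close> leaves these domains unchanged.\<close>

lemma pb_parallel_spans:
  assumes "a \<in> cospans C S" "b \<in> cospans C S" "cospan_le C S a b" "is_pb C a p" "is_pb C b q"
  shows "(p, q) \<in> parallel_spans"
proof -
  obtain f s g t s' f' t' g' where 1: "a = (f, s)" "b = (g, t)" "p = (s', f')" "q = (t', g')"
    by (metis surj_pair)
  have pb: "is_pullback C f s s' f'" "is_pullback C g t t' g'"
    using assms(4,5) unfolding is_pb_def 1 by auto
  have S: "s \<in> S" "t \<in> S" using assms(1,2) unfolding cospans_def 1 by auto
  obtain v where v: "v \<in> S" "cdom C v = ccod C s" "v \<cdot> f = g" "v \<cdot> s = t"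
    using assms(3) unfolding cospan_le_def 1 by auto
  have vh: "v \<in> hom C (ccod C s) (ccod C v)" using arr_hom[of v] S_arr v by auto
  have "ccod C f = ccod C s" "f \<in> arr C" "s \<in> arr C" using pb unfolding is_pullback_def by auto
  then have "cdom C g = cdom C f" "cdom C t = cdom C s"
    using comp_hom[OF _ vh] v(3,4) arr_hom homD by metis+
  then show ?thesis
    using pb S_pullback[OF S(1) pb(1)] S_pullback[OF S(2) pb(2)] unfolding 1
    by (auto simp: parallel_spans_def is_pullback_def spans_def span_dom_def span_cod_def)
qed

lemma approx_a_least:
  assumes "compatible C S R"
    and "\<And>a b p q. \<lbrakk>a \<in> cospans C S; b \<in> cospans C S; cospan_le C S a b; is_pb C a p; is_pb C b q\<rbrakk>
      \<Longrightarrow> (p, q) \<in> R"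
  shows "approx_a C S \<subseteq> R"
  using assms unfolding approx_a_def by blast

lemma approx_a_parallel: "approx_a C S \<subseteq> parallel_spans"
  by (rule approx_a_least[OF compatible_parallel_spans pb_parallel_spans])

lemma compatibleD:
  assumes "compatible C S R" "(p, q) \<in> R" "r \<in> spans C S"
  shows "\<lbrakk>span_comp C r p c; span_comp C r q d\<rbrakk> \<Longrightarrow> (c, d) \<in> R"
    and "\<lbrakk>span_comp C p r c; span_comp C q r d\<rbrakk> \<Longrightarrow> (c, d) \<in> R"
  using assms unfolding compatible_def by blast+

text \<open>Containing \<open>span_iso\<close> and closure under composition pass to any
  intersection. That related spans are parallel needs a member of the family, and
  \<open>parallel_spans\<close> provides it.\<close>

lemma compatible_approx_a: "compatible C S (approx_a C S)"
proof -
  define \<R> where "\<R> = {R. compatible C S R \<and>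
     (\<forall>a \<in> cospans C S. \<forall>b \<in> cospans C S. \<forall>p q.
        cospan_le C S a b \<and> is_pb C a p \<and> is_pb C b q \<longrightarrow> (p, q) \<in> R)}"
  have a: "approx_a C S = \<Inter>\<R>" unfolding approx_a_def \<R>_def ..
  have c: "\<And>R. R \<in> \<R> \<Longrightarrow> compatible C S R" unfolding \<R>_def by blast
  have "(c, d) \<in> approx_a C S"
    if "(p, q) \<in> approx_a C S" "r \<in> spans C S"
      "span_comp C r p c \<and> span_comp C r q d \<or> span_comp C p r c \<and> span_comp C q r d" for p q r c d
    unfolding a using compatibleD[OF c] that[unfolded a] by blast
  moreover have "span_iso C S \<subseteq> approx_a C S"
    unfolding a using c unfolding compatible_def by blast
  ultimately show ?thesis
    using approx_a_parallel unfolding compatible_def parallel_spans_def by blast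
qed

lemma sim_a_least: "\<lbrakk>equiv (spans C S) E; approx_a C S \<subseteq> E\<rbrakk> \<Longrightarrow> sim_a C S \<subseteq> E"
  unfolding sim_a_def by blast

lemma approx_sub_sim_a: "approx_a C S \<subseteq> sim_a C S"
  unfolding sim_a_def by blast

lemma span_iso_sub_sim_a: "span_iso C S \<subseteq> sim_a C S"
  using approx_sub_sim_a compatible_approx_a unfolding compatible_def by blast

lemma sim_a_parallel: "sim_a C S \<subseteq> parallel_spans"
  by (rule sim_a_least[OF equiv_parallel_spans approx_a_parallel])

lemma equiv_sim_a: "equiv (spans C S) (sim_a C S)"
proof (rule equivI)
  show "sim_a C S \<subseteq> spans C S \<times> spans C S"
    using sim_a_parallel unfolding parallel_spans_def by blast
  show "refl_on (spans C S) (sim_a C S)"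
    unfolding sim_a_def refl_on_def equiv_def by blast
  show "sym (sim_a C S)"
    unfolding sim_a_def by (rule symI) (clarsimp, meson equivE symD)
  show "trans (sim_a C S)"
    unfolding sim_a_def by (rule transI) (clarsimp, meson equivE transD)
qed

lemma sim_a_trans: "\<lbrakk>(p, q) \<in> sim_a C S; (q, r) \<in> sim_a C S\<rbrakk> \<Longrightarrow> (p, r) \<in> sim_a C S"
  and sim_a_sym: "(p, q) \<in> sim_a C S \<Longrightarrow> (q, p) \<in> sim_a C S"
  and sim_a_refl: "p \<in> spans C S \<Longrightarrow> (p, p) \<in> sim_a C S"
  using equiv_sim_a unfolding equiv_def refl_on_def by (meson transD symD)+

lemma sim_aD:
  "(p, q) \<in> sim_a C S \<Longrightarrow> p \<in> spans C S \<and> q \<in> spans C S \<and>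
     span_dom C p = span_dom C q \<and> span_cod C p = span_cod C q"
  using sim_a_parallel unfolding parallel_spans_def by blast

text \<open>Transitivity of the auxiliary relation in the next two proofs uses that composability depends only on the domains and
  codomains, so that a composite with the middle span exists.\<close>

lemma sim_a_comp_left:
  assumes "(p, q) \<in> sim_a C S" "r \<in> spans C S" "span_comp C r p c" "span_comp C r q d"
  shows "(c, d) \<in> sim_a C S"
proof -
  \<comment> \<open>As \<open>sim_a\<close> is an intersection, the claim is built into an
    equivalence relation that contains \<open>approx_a\<close>; minimality of \<open>sim_a\<close>
    then gives it for all related pairs.\<close>
  let ?E = "{(p, q) \<in> sim_a C S. \<forall>r\<in>spans C S. \<forall>c d. span_comp C r p c \<and> span_comp C r q d \<longrightarrow>
      (c, d) \<in> sim_a C S}"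
  have "equiv (spans C S) ?E"
  proof (intro equivI refl_onI symI transI)
    show "?E \<subseteq> spans C S \<times> spans C S" using sim_aD by blast
    \<comment> \<open>Even reflexivity has content: \<open>c\<close> and \<open>d\<close> may come
      from different pullbacks, and are then isomorphic.\<close>
    show "(p, p) \<in> ?E" if "p \<in> spans C S" for p
      using that sim_a_refl span_comp_unique span_iso_sub_sim_a by blast
    show "(q, p) \<in> ?E" if "(p, q) \<in> ?E" for p q
      using that sim_a_sym by blast
    show "(p, q') \<in> ?E" if pq: "(p, q) \<in> ?E" and qq: "(q, q') \<in> ?E" for p q q'
    proof -
      have "(c, d) \<in> sim_a C S" if r: "r \<in> spans C S" "span_comp C r p c" "span_comp C r q' d" for r c d
      proof -
        have "p \<in> spans C S" "q \<in> spans C S" "span_cod C p = span_cod C q"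
          using sim_aD[of p q] pq by auto
        then obtain e where "span_comp C r q e"
          using span_comp_span(4)[OF r(2,1)] span_comp_ex[OF r(1)] by metis
        then show ?thesis using pq qq r sim_a_trans by blast
      qed
      then show ?thesis using sim_a_trans pq qq by blast
    qed
  qed
  moreover have "approx_a C S \<subseteq> ?E"
    using approx_sub_sim_a compatible_approx_a unfolding compatible_def by blast
  ultimately have "sim_a C S \<subseteq> ?E" by (rule sim_a_least)
  then show ?thesis using assms by blast
qed

lemma sim_a_comp_right:
  assumes "(p, q) \<in> sim_a C S" "r \<in> spans C S" "span_comp C p r c" "span_comp C q r d"
  shows "(c, d) \<in> sim_a C S"
proof -
  let ?E = "{(p, q) \<in> sim_a C S. \<forall>r\<in>spans C S. \<forall>c d. span_comp C p r c \<and> span_comp C q r d \<longrightarrow>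
      (c, d) \<in> sim_a C S}"
  have "equiv (spans C S) ?E"
  proof (intro equivI refl_onI symI transI)
    show "?E \<subseteq> spans C S \<times> spans C S" using sim_aD by blast
    show "(p, p) \<in> ?E" if "p \<in> spans C S" for p
      using that sim_a_refl span_comp_unique span_iso_sub_sim_a by blast
    show "(q, p) \<in> ?E" if "(p, q) \<in> ?E" for p q
      using that sim_a_sym by blast
    show "(p, q') \<in> ?E" if pq: "(p, q) \<in> ?E" and qq: "(q, q') \<in> ?E" for p q q'
    proof -
      have "(c, d) \<in> sim_a C S" if r: "r \<in> spans C S" "span_comp C p r c" "span_comp C q' r d" for r c d
      proof -
        have "p \<in> spans C S" "q \<in> spans C S" "span_dom C p = span_dom C q"
          using sim_aD[of p q] pq by auto
        then obtain e where "span_comp C q r e"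
          using span_comp_span(4)[OF r(2) _ r(1)] span_comp_ex[OF _ r(1)] by metis
        then show ?thesis using pq qq r sim_a_trans by blast
      qed
      then show ?thesis using sim_a_trans pq qq by blast
    qed
  qed
  moreover have "approx_a C S \<subseteq> ?E"
    using approx_sub_sim_a compatible_approx_a unfolding compatible_def by blast
  ultimately have "sim_a C S \<subseteq> ?E" by (rule sim_a_least)
  then show ?thesis using assms by blast
qed

text \<open>The generating pairs of the relation, with the larger cospan written as
  \<open>\<langle>v \<cdot> f, v \<cdot> s\<rangle>\<close> so that \<open>v\<close> itself
  witnesses the order.\<close>

lemma sim_a_pb:
  assumes "is_pullback C f s s' f'" "is_pullback C (v \<cdot> f) (v \<cdot> s) t' g'"
    and "s \<in> S" "v \<in> S" "s \<in> hom C B D" "v \<in> hom C D E"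
  shows "((s', f'), (t', g')) \<in> sim_a C S"
proof -
  have vs: "v \<cdot> s \<in> S" using S_comp assms homD by metis
  have f: "f \<in> arr C" "ccod C f = D" "ccod C s = D" "ccod C (v \<cdot> s) = E" "cdom C v = D" "ccod C v = E"
    using assms(1) homD[OF assms(5)] homD[OF assms(6)] homD[OF comp_hom[OF assms(5,6)]]
    unfolding is_pullback_def by auto
  then have "v \<cdot> f \<in> hom C (cdom C f) E" using comp_hom arr_hom assms(6) by metis
  then have c: "(f, s) \<in> cospans C S" "(v \<cdot> f, v \<cdot> s) \<in> cospans C S"
    using f vs assms(3) unfolding cospans_def hom_def by auto
  have "cospan_le C S (f, s) (v \<cdot> f, v \<cdot> s)" "is_pb C (f, s) (s', f')" "is_pb C (v \<cdot> f, v \<cdot> s) (t', g')"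
    using assms(1,2,4) f unfolding cospan_le_def is_pb_def by auto
  then show ?thesis using c approx_sub_sim_a unfolding approx_a_def by blast
qed

end

section \<open>The category of sections\<close>

lemma the_elem_image:
  assumes "x \<in> X" "\<And>y. y \<in> X \<Longrightarrow> f y = a"
  shows "the_elem (f ` X) = a"
proof -
  have "f ` X = {a}" using assms by auto
  then show ?thesis by simp
qed

lemma card_image_le_1:
  assumes "\<And>x y. \<lbrakk>x \<in> P; y \<in> P\<rbrakk> \<Longrightarrow> f x = f y"
  shows "finite (f ` P)" "card (f ` P) \<le> 1"
proof -
  have "f ` P = {} \<or> (\<exists>a. f ` P = {a})" using assms by blast
  then show "finite (f ` P)" "card (f ` P) \<le> 1" by auto
qed

context stable_class
begin

lemma span_compI:
  "is_pullback C f t t' f' \<Longrightarrow> span_comp C (t, g) (s, f) (s \<cdot> t', g \<cdot> f')"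
  unfolding span_comp_def by blast

section \<open>Arrows of \<open>Sect\<close> named by representing spans\<close>

definition span_class where
  "span_class p = span_iso C S `` {p}"

text \<open>An arrow of \<open>Sect\<close> is formally a set of sets of spans. Naming it by one
  span lets equality and composition be computed with \<open>sim_a\<close> and
  \<open>span_comp\<close>.\<close>

definition sect_class where
  "sect_class p = sim_a_classes C S `` {span_class p}"

lemma arr_Span: "arr (Span C S) = span_class ` spans C S"
  unfolding Span_def span_class_def quotient_def by auto

lemma mem_span_class: "q \<in> span_class p \<longleftrightarrow> (p, q) \<in> span_iso C S"
  unfolding span_class_def by simp

text \<open>The induced relation asks only for some related representatives; isomorphic spans are
  already related by \<open>sim_a\<close>, so the choice does not matter.\<close>

lemma sim_a_classes_iff:
  assumes "p \<in> spans C S" "q \<in> spans C S"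
  shows "(span_class p, span_class q) \<in> sim_a_classes C S \<longleftrightarrow> (p, q) \<in> sim_a C S"
proof
  assume "(span_class p, span_class q) \<in> sim_a_classes C S"
  then obtain p' q' where "(p, p') \<in> span_iso C S" "(q, q') \<in> span_iso C S" "(p', q') \<in> sim_a C S"
    unfolding sim_a_classes_def mem_span_class[symmetric] by blast
  then show "(p, q) \<in> sim_a C S"
    using span_iso_sub_sim_a sim_a_sym sim_a_trans by (meson subsetD)
next
  assume "(p, q) \<in> sim_a C S"
  then show "(span_class p, span_class q) \<in> sim_a_classes C S"
    unfolding sim_a_classes_def using assms arr_Span mem_span_class span_iso_refl by blast
qed

lemma sim_a_classes_sub: "sim_a_classes C S \<subseteq> arr (Span C S) \<times> arr (Span C S)"
  unfolding sim_a_classes_def by blast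

lemma equiv_sim_a_classes: "equiv (arr (Span C S)) (sim_a_classes C S)"
proof (intro equivI refl_onI symI transI)
  show "sim_a_classes C S \<subseteq> arr (Span C S) \<times> arr (Span C S)" by (rule sim_a_classes_sub)
  fix X assume "X \<in> arr (Span C S)"
  then obtain p where "p \<in> spans C S" "X = span_class p" unfolding arr_Span by blast
  then show "(X, X) \<in> sim_a_classes C S" using sim_a_classes_iff sim_a_refl by simp
next
  show "(Y, X) \<in> sim_a_classes C S" if "(X, Y) \<in> sim_a_classes C S" for X Y
    using that sim_a_sym unfolding sim_a_classes_def by blast
  show "(X, Z) \<in> sim_a_classes C S"
    if XY: "(X, Y) \<in> sim_a_classes C S" and YZ: "(Y, Z) \<in> sim_a_classes C S" for X Y Z
  proof -
    have "X \<in> arr (Span C S)" "Y \<in> arr (Span C S)" "Z \<in> arr (Span C S)"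
      using XY YZ unfolding sim_a_classes_def by auto
    then obtain p q r where *: "p \<in> spans C S" "q \<in> spans C S" "r \<in> spans C S"
      and eq: "X = span_class p" "Y = span_class q" "Z = span_class r"
      unfolding arr_Span by blast
    have "(p, q) \<in> sim_a C S" "(q, r) \<in> sim_a C S"
      using XY YZ * sim_a_classes_iff unfolding eq by blast+
    then have "(p, r) \<in> sim_a C S" by (rule sim_a_trans)
    then show ?thesis using * sim_a_classes_iff unfolding eq by blast
  qed
qed

lemma sect_class_eq:
  assumes "p \<in> spans C S" "q \<in> spans C S"
  shows "sect_class p = sect_class q \<longleftrightarrow> (p, q) \<in> sim_a C S"
  unfolding sect_class_def
  using eq_equiv_class_iff[OF equiv_sim_a_classes, of "span_class p" "span_class q"]
    sim_a_classes_iff[OF assms] assms arr_Span by auto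

lemma mem_sect_class:
  assumes "p \<in> spans C S"
  shows "X \<in> sect_class p \<longleftrightarrow> (\<exists>q. (p, q) \<in> sim_a C S \<and> X = span_class q)"
proof
  assume X: "X \<in> sect_class p"
  then obtain q where "q \<in> spans C S" "X = span_class q"
    unfolding sect_class_def using sim_a_classes_sub arr_Span by blast
  then show "\<exists>q. (p, q) \<in> sim_a C S \<and> X = span_class q"
    using X assms sim_a_classes_iff[of p q] unfolding sect_class_def Image_singleton_iff by blast
next
  assume "\<exists>q. (p, q) \<in> sim_a C S \<and> X = span_class q"
  then show "X \<in> sect_class p"
    using assms sim_a_classes_iff sim_aD unfolding sect_class_def by fast
qed

lemma Span_dom_cod:
  assumes "p \<in> spans C S"
  shows "cdom (Span C S) (span_class p) = span_dom C p" "ccod (Span C S) (span_class p) = span_cod C p"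
proof -
  have p: "p \<in> span_class p" using mem_span_class span_iso_refl assms by blast
  have "span_dom C q = span_dom C p \<and> span_cod C q = span_cod C p" if "q \<in> span_class p" for q
    using that span_iso_parallel unfolding mem_span_class parallel_spans_def by fastforce
  then show "cdom (Span C S) (span_class p) = span_dom C p" "ccod (Span C S) (span_class p) = span_cod C p"
    using the_elem_image[OF p, of "span_dom C"] the_elem_image[OF p, of "span_cod C"]
    unfolding Span_def by simp_all
qed

lemma Sect_dom_cod:
  assumes "p \<in> spans C S"
  shows "cdom (Sect C S) (sect_class p) = span_dom C p" "ccod (Sect C S) (sect_class p) = span_cod C p"
proof -
  have p: "span_class p \<in> sect_class p" using mem_sect_class sim_a_refl assms by blast
  have "cdom (Span C S) X = span_dom C p \<and> ccod (Span C S) X = span_cod C p" if "X \<in> sect_class p" for X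
    using that mem_sect_class[OF assms] sim_aD Span_dom_cod by metis
  then show "cdom (Sect C S) (sect_class p) = span_dom C p" "ccod (Sect C S) (sect_class p) = span_cod C p"
    using the_elem_image[OF p, of "cdom (Span C S)"] the_elem_image[OF p, of "ccod (Span C S)"]
    unfolding Sect_def quotient_cat_def by simp_all
qed

lemma arr_Sect: "arr (Sect C S) = sect_class ` spans C S"
  unfolding Sect_def quotient_cat_def quotient_def arr_Span sect_class_def by auto

lemma hom_Sect:
  "hom (Sect C S) A B = sect_class ` {p \<in> spans C S. span_dom C p = A \<and> span_cod C p = B}"
  unfolding hom_def arr_Sect using Sect_dom_cod by auto

lemma obj_Sect: "obj (Sect C S) = obj C"
  unfolding Sect_def quotient_cat_def Span_def by simp

lemma cid_Sect: "cid (Sect C S) A = sect_class (cid C A, cid C A)"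
  unfolding Sect_def quotient_cat_def Span_def sect_class_def span_class_def by simp

text \<open>The composite of two classes collects all composites of all representatives. Changing
  representatives adds nothing, and the composites of one fixed pair already form a whole
  class.\<close>

lemma comp_Span:
  assumes "q \<in> spans C S" "p \<in> spans C S" "span_comp C q p c"
  shows "comp (Span C S) (span_class q) (span_class p) = span_class c"
proof -
  have "comp (Span C S) (span_class q) (span_class p) =
      {d. \<exists>q' p'. (q, q') \<in> span_iso C S \<and> (p, p') \<in> span_iso C S \<and> span_comp C q' p' d}"
    unfolding Span_def span_class_def by auto
  also have "\<dots> = {d. span_comp C q p d}"
    using span_comp_iso_args span_iso_sym span_iso_refl assms(1,2) by blast
  also have "\<dots> = span_class c"
    using span_comp_unique span_comp_iso_result assms unfolding span_class_def by blast
  finally show ?thesis .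
qed

lemma comp_Sect:
  assumes q: "q \<in> spans C S" and p: "p \<in> spans C S" and c: "span_comp C q p c"
  shows "comp (Sect C S) (sect_class q) (sect_class p) = sect_class c"
proof -
  have eq: "sim_a_classes C S `` {comp (Span C S) Y X} = sect_class c"
    if Y: "Y \<in> sect_class q" and X: "X \<in> sect_class p" for X Y
  proof -
    obtain q' p' where q': "(q, q') \<in> sim_a C S" "Y = span_class q'"
      and p': "(p, p') \<in> sim_a C S" "X = span_class p'"
      using X Y mem_sect_class p q by metis
    have S: "q' \<in> spans C S" "p' \<in> spans C S" using q' p' sim_aD by blast+
    have m: "span_cod C p = span_dom C q" using span_comp_span(4)[OF c q p] .
    \<comment> \<open>The span \<open>d\<close> mediates between \<open>c\<close> and
      \<open>e\<close>, so that only one factor changes at a time.\<close>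
    obtain d where d: "span_comp C q p' d"
      using span_comp_ex[OF q S(2)] m sim_aD[OF p'(1)] by metis
    obtain e where e: "span_comp C q' p' e"
      using span_comp_ex[OF S] m sim_aD[OF p'(1)] sim_aD[OF q'(1)] by metis
    have "(c, d) \<in> sim_a C S" by (rule sim_a_comp_left[OF p'(1) q c d])
    moreover have "(d, e) \<in> sim_a C S" by (rule sim_a_comp_right[OF q'(1) S(2) d e])
    ultimately have "(c, e) \<in> sim_a C S" by (rule sim_a_trans)
    then have "sect_class e = sect_class c" using sect_class_eq sim_aD by metis
    then show ?thesis using comp_Span[OF S e] q' p' unfolding sect_class_def by simp
  qed
  have "span_class q \<in> sect_class q" "span_class p \<in> sect_class p"
    using mem_sect_class sim_a_refl p q by blast+
  moreover have "comp (Sect C S) (sect_class q) (sect_class p) =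
      (\<Union>Y\<in>sect_class q. \<Union>X\<in>sect_class p. sim_a_classes C S `` {comp (Span C S) Y X})"
    unfolding Sect_def quotient_cat_def by simp
  ultimately show ?thesis using eq by auto
qed

text \<open>Typing laws in the form expected by \<open>category_of_singleton_homs\<close>, where
  uniqueness of arrows supplies the unit and associativity laws.\<close>

lemma Sect_structure:
  shows "F \<in> arr (Sect C S) \<Longrightarrow> cdom (Sect C S) F \<in> obj (Sect C S) \<and> ccod (Sect C S) F \<in> obj (Sect C S)"
    and "A \<in> obj (Sect C S) \<Longrightarrow> cid (Sect C S) A \<in> hom (Sect C S) A A"
    and "\<lbrakk>F \<in> hom (Sect C S) X Y; G \<in> hom (Sect C S) Y Z\<rbrakk> \<Longrightarrow> comp (Sect C S) G F \<in> hom (Sect C S) X Z"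
proof -
  assume "F \<in> arr (Sect C S)"
  then obtain p where p: "p \<in> spans C S" "F = sect_class p" using arr_Sect by auto
  then have "span_dom C p \<in> obj C" "span_cod C p \<in> obj C"
    using spansE span_dom_simp span_cod_simp homD by metis+
  then show "cdom (Sect C S) F \<in> obj (Sect C S) \<and> ccod (Sect C S) F \<in> obj (Sect C S)"
    using Sect_dom_cod p obj_Sect by simp
next
  assume "A \<in> obj (Sect C S)"
  then have "A \<in> obj C" using obj_Sect by simp
  then show "cid (Sect C S) A \<in> hom (Sect C S) A A"
    unfolding hom_Sect cid_Sect
    using id_hom cid_S spansI span_dom_simp span_cod_simp by blast
next
  assume "F \<in> hom (Sect C S) X Y" "G \<in> hom (Sect C S) Y Z"
  then obtain p q where p: "p \<in> spans C S" "F = sect_class p" "span_dom C p = X" "span_cod C p = Y"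
    and q: "q \<in> spans C S" "G = sect_class q" "span_dom C q = Y" "span_cod C q = Z"
    unfolding hom_Sect by blast
  obtain c where c: "span_comp C q p c" using span_comp_ex[OF q(1) p(1)] p q by metis
  show "comp (Sect C S) G F \<in> hom (Sect C S) X Z"
    using comp_Sect[OF q(1) p(1) c] span_comp_span[OF c q(1) p(1)] p q unfolding hom_Sect by auto
qed

text \<open>Initiality of the first apex gives an arrow to the second and makes both triangles
  commute; strictness of the second apex makes that arrow invertible.\<close>

lemma span_iso_strict_initial:
  assumes "(s, f) \<in> spans C S" "(s2, f2) \<in> spans C S"
    and "span_dom C (s, f) = span_dom C (s2, f2)" "span_cod C (s, f) = span_cod C (s2, f2)"
    and D: "strict_initial C (cdom C s)" and D2: "strict_initial C (cdom C s2)"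
  shows "((s, f), (s2, f2)) \<in> span_iso C S"
proof -
  obtain D A B where 1: "s \<in> S" "s \<in> hom C D A" "f \<in> hom C D B"
    using assms(1) by (rule spansE) auto
  obtain D2 A2 B2 where 2: "s2 \<in> S" "s2 \<in> hom C D2 A2" "f2 \<in> hom C D2 B2"
    using assms(2) by (rule spansE) auto
  have e: "A2 = A" "B2 = B" "cdom C s = D" "cdom C s2 = D2"
    using assms(3,4) span_dom_simp[OF 1(2)] span_cod_simp[OF 1(3)] span_dom_simp[OF 2(2)]
      span_cod_simp[OF 2(3)] homD[OF 1(2)] homD[OF 2(2)] by auto
  have init: "\<exists>!k. k \<in> hom C D X" if "X \<in> obj C" for X
    using D that e unfolding strict_initial_def initial_obj_def by simp
  obtain x where x: "x \<in> hom C D D2" using init homD[OF 2(2)] by blast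
  have "iso C x" using D2[unfolded e] x homD[OF x] unfolding strict_initial_def by blast
  moreover have "s2 \<cdot> x = s"
    using init[of A] comp_hom[OF x 2(2)] 1(2) homD[OF 1(2)] unfolding e by blast
  moreover have "f2 \<cdot> x = f"
    using init[of B] comp_hom[OF x 2(3)] 1(3) homD[OF 1(3)] unfolding e by blast
  ultimately show ?thesis using span_isoI[OF 1(1) 2(1) 2(2) 2(3) x] by blast
qed

end

section \<open>Strictly connected categories\<close>

locale strictly_connected_class = stable_class C S
  for C :: "('o, 'm) cat" (structure) and S :: "'m set" +
  fixes one :: 'o
  assumes terminal: "terminal_obj C one"
    and connected: "strictly_connected C"
    and S_terminal: "\<lbrakk>A \<in> obj C; \<not> strict_initial C A; t \<in> hom C A one\<rbrakk> \<Longrightarrow> t \<in> S"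
begin

lemma hom_nonempty: "\<lbrakk>A \<in> obj C; B \<in> obj C; \<not> strict_initial C B\<rbrakk> \<Longrightarrow> \<exists>h. h \<in> hom C A B"
  using connected unfolding strictly_connected_def by blast

text \<open>Both spans are pullbacks of cospans \<open>\<langle>f, 1\<rangle>\<close> below the cospan formed by the maps to the
  terminal object.\<close>

lemma sim_a_graphs:
  assumes f: "f \<in> hom C X Y" and f': "f' \<in> hom C X Y" and Y: "\<not> strict_initial C Y"
  shows "((cid C X, f), (cid C X, f')) \<in> sim_a C S"
proof -
  have o: "X \<in> obj C" "Y \<in> obj C" using homD[OF f] by auto
  obtain a b where a: "a \<in> hom C X one" and b: "b \<in> hom C Y one"
    using terminal o unfolding terminal_obj_def by blast
  have bS: "b \<in> S" using S_terminal o Y b by blast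
  \<comment> \<open>A pullback over the terminal object, that is, a product of \<open>X\<close> and
    \<open>Y\<close>. It involves no particular arrow from \<open>X\<close> to \<open>Y\<close>, so
    the graphs of all of them are related to the one span \<open>(t', g')\<close>.\<close>
  obtain t' g' where pb: "is_pullback C a b t' g'"
    using S_pullback_ex[OF bS] homD[OF a] homD[OF b] by metis
  have "((cid C X, g), (t', g')) \<in> sim_a C S" if g: "g \<in> hom C X Y" for g
  proof (rule sim_a_pb[OF pullback_id_right[OF g] _ cid_S[OF o(2)] bS id_hom[OF o(2)] b])
    have "b \<cdot> g = a" using comp_hom[OF g b] a terminal o unfolding terminal_obj_def by blast
    then show "is_pullback C (b \<cdot> g) (b \<cdot> cid C Y) t' g'" using pb comp_id_right[OF b] by simp
  qed
  then show ?thesis using f f' sim_a_sym sim_a_trans by blast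
qed

text \<open>With \<open>(k, l)\<close> a pullback of the cospan \<open>\<langle>s \<cdot> h, s\<rangle>\<close>, the span \<open>(k, f \<cdot> l)\<close> is both
  \<open>(s, f)\<close> after the graph of \<open>s \<cdot> h\<close>, hence equivalent to \<open>(s, f)\<close>, and \<open>f\<close> after \<open>(k, l)\<close>, where
  \<open>(k, l)\<close> is equivalent to the graph of \<open>h\<close> because \<open>\<langle>h, 1\<rangle> \<preceq> \<langle>s \<cdot> h, s\<rangle>\<close>.\<close>

lemma sim_a_span_graph:
  assumes sS: "s \<in> S" and s: "s \<in> hom C D A" and f: "f \<in> hom C D B" and h: "h \<in> hom C A D"
    and D: "\<not> strict_initial C D"
  shows "((s, f), (cid C A, f \<cdot> h)) \<in> sim_a C S"
proof -
  have o: "A \<in> obj C" "D \<in> obj C" using homD[OF s] by auto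
  have A: "\<not> strict_initial C A" using strict_initial_source D s by blast
  have sh: "s \<cdot> h \<in> hom C A A" using comp_hom h s .
  obtain k l where pb: "is_pullback C (s \<cdot> h) s k l"
    using S_pullback_ex[OF sS] homD[OF sh] homD[OF s] by metis
  define P where "P = cdom C k"
  have k: "k \<in> hom C P A" and l: "l \<in> hom C P D"
    using pb homD[OF sh] homD[OF s] unfolding is_pullback_def hom_def P_def by auto
  have kS: "k \<in> S" using S_pullback sS pb by blast
  have "((cid C A, h), (k, l)) \<in> sim_a C S"
    using sim_a_pb[OF pullback_id_right[OF h] _ cid_S[OF o(2)] sS id_hom[OF o(2)] s] pb
      comp_id_right[OF s] by simp
  moreover have "span_comp C (cid C D, f) (cid C A, h) (cid C A, f \<cdot> h)"
    using span_compI[OF pullback_id_right[OF h], of f "cid C A"] comp_id_left[OF id_hom[OF o(1)]] by simp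
  moreover have "span_comp C (cid C D, f) (k, l) (k, f \<cdot> l)"
    using span_compI[OF pullback_id_right[OF l], of f k] comp_id_right[OF k] by simp
  moreover have "(cid C D, f) \<in> spans C S" using spansI[OF cid_S id_hom f] o by blast
  ultimately have 1: "((cid C A, f \<cdot> h), (k, f \<cdot> l)) \<in> sim_a C S"
    using sim_a_comp_left by blast
  \<comment> \<open>This stands in for \<open>h\<close> being a section of \<open>s\<close>; it
    relies on \<open>A\<close> not being strict initial.\<close>
  have "((cid C A, s \<cdot> h), (cid C A, cid C A)) \<in> sim_a C S"
    using sim_a_graphs sh id_hom[OF o(1)] A by blast
  moreover have "span_comp C (s, f) (cid C A, s \<cdot> h) (k, f \<cdot> l)"
    using span_compI[OF pb, of f "cid C A"] comp_id_left[OF k] by simp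
  moreover have "span_comp C (s, f) (cid C A, cid C A) (s, f)"
    using span_compI[OF pullback_id_left[OF s], of f "cid C A"] comp_id_left[OF s] comp_id_right[OF f] by simp
  ultimately have "((k, f \<cdot> l), (s, f)) \<in> sim_a C S"
    using sim_a_comp_left spansI[OF sS s f] by blast
  then show ?thesis using 1 sim_a_sym sim_a_trans by blast
qed

lemma sim_a_not_strict_initial:
  assumes "(s, f) \<in> spans C S" "(s2, f2) \<in> spans C S"
    and "span_dom C (s, f) = span_dom C (s2, f2)" "span_cod C (s, f) = span_cod C (s2, f2)"
    and D: "\<not> strict_initial C (cdom C s)" and D2: "\<not> strict_initial C (cdom C s2)"
  shows "((s, f), (s2, f2)) \<in> sim_a C S"
proof -
  obtain D A B where 1: "s \<in> S" "s \<in> hom C D A" "f \<in> hom C D B"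
    using assms(1) by (rule spansE) auto
  obtain D2 A2 B2 where 2: "s2 \<in> S" "s2 \<in> hom C D2 A2" "f2 \<in> hom C D2 B2"
    using assms(2) by (rule spansE) auto
  have e: "A2 = A" "B2 = B" "cdom C s = D" "cdom C s2 = D2"
    using assms(3,4) span_dom_simp[OF 1(2)] span_cod_simp[OF 1(3)] span_dom_simp[OF 2(2)]
      span_cod_simp[OF 2(3)] homD[OF 1(2)] homD[OF 2(2)] by auto
  note 2 = 2[unfolded e] and ns = D[unfolded e] D2[unfolded e]
  obtain h h2 where h: "h \<in> hom C A D" "h2 \<in> hom C A D2"
    using hom_nonempty ns homD[OF 1(2)] homD[OF 2(2)] by blast
  \<comment> \<open>The arrow \<open>f\<close> from \<open>D\<close> passes the property on to
    \<open>B\<close>, which allows the two graphs into \<open>B\<close> to be compared.\<close>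
  have "\<not> strict_initial C B" using strict_initial_source 1(3) ns(1) by blast
  then have "((cid C A, f \<cdot> h), (cid C A, f2 \<cdot> h2)) \<in> sim_a C S"
    using sim_a_graphs comp_hom[OF h(1) 1(3)] comp_hom[OF h(2) 2(3)] by blast
  then show ?thesis
    using sim_a_span_graph[OF 1 h(1) ns(1)] sim_a_span_graph[OF 2 h(2) ns(2)] sim_a_sym sim_a_trans by blast
qed

text \<open>The spans are split by whether their apex is strict initial, and each family yields at
  most one class. Only upper bounds result: a family may be empty, and the two classes may coincide,
  as for sets with all maps in \<open>S\<close>, where two distinct points of a two-element set have
  empty pullback but become equal in the one-element set.\<close>

lemma card_hom_Sect:
  shows "finite (hom (Sect C S) A B)" "card (hom (Sect C S) A B) \<le> 2"
    and "\<nexists>Z. strict_initial C Z \<Longrightarrow> card (hom (Sect C S) A B) \<le> 1"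
proof -
  let ?P = "{p \<in> spans C S. span_dom C p = A \<and> span_cod C p = B}"
  let ?I = "{p \<in> ?P. strict_initial C (cdom C (fst p))}"
  let ?N = "{p \<in> ?P. \<not> strict_initial C (cdom C (fst p))}"
  have "sect_class p = sect_class q" if "p \<in> ?I" "q \<in> ?I" for p q
  proof -
    have "(p, q) \<in> span_iso C S"
      using that span_iso_strict_initial[of "fst p" "snd p" "fst q" "snd q"] by simp
    then show ?thesis using that sect_class_eq span_iso_sub_sim_a by blast
  qed
  note I = card_image_le_1[of ?I sect_class, OF this]
  have "sect_class p = sect_class q" if "p \<in> ?N" "q \<in> ?N" for p q
  proof -
    have "(p, q) \<in> sim_a C S"
      using that sim_a_not_strict_initial[of "fst p" "snd p" "fst q" "snd q"] by simp
    then show ?thesis using that sect_class_eq by blast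
  qed
  note N = card_image_le_1[of ?N sect_class, OF this]
  have "?P = ?I \<union> ?N" by blast
  then have eq: "hom (Sect C S) A B = sect_class ` ?I \<union> sect_class ` ?N"
    unfolding hom_Sect image_Un[symmetric] by (rule arg_cong)
  show "finite (hom (Sect C S) A B)" unfolding eq using I N by blast
  show "card (hom (Sect C S) A B) \<le> 2"
    unfolding eq using I(2) N(2) card_Un_le[of "sect_class ` ?I" "sect_class ` ?N"] by linarith
  show "card (hom (Sect C S) A B) \<le> 1" if "\<nexists>Z. strict_initial C Z"
  proof -
    have "?I = {}" using that by blast
    then have "hom (Sect C S) A B = sect_class ` ?N" unfolding eq by blast
    then show ?thesis using N(2) by (rule ssubst)
  qed
qed

lemma hom_Sect_empty_iff:
  assumes A: "A \<in> obj C" and B: "B \<in> obj C"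
  shows "hom (Sect C S) A B = {} \<longleftrightarrow> strict_initial C B \<and> hom C B A \<inter> S = {}"
proof
  assume e: "hom (Sect C S) A B = {}"
  have none: False if "s \<in> S" "s \<in> hom C D A" "f \<in> hom C D B" for s f D
    using e spansI[OF that] span_dom_simp[OF that(2)] span_cod_simp[OF that(3)] unfolding hom_Sect by blast
  \<comment> \<open>Emptiness is refuted by the graph of an arrow from \<open>A\<close> to
    \<open>B\<close> if \<open>B\<close> is not strict initial, and by \<open>(s, 1)\<close> if some
    \<open>s\<close> from \<open>B\<close> to \<open>A\<close> lies in \<open>S\<close>.\<close>
  show "strict_initial C B \<and> hom C B A \<inter> S = {}"
    using none id_hom[OF A] id_hom[OF B] cid_S[OF A] hom_nonempty[OF A B] by blast
next
  assume B: "strict_initial C B \<and> hom C B A \<inter> S = {}"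
  have False if p: "p \<in> spans C S" "span_dom C p = A" "span_cod C p = B" for p
  proof -
    obtain s f D A' B' where 1: "p = (s, f)" "s \<in> S" "s \<in> hom C D A'" "f \<in> hom C D B'"
      using p(1) by (rule spansE)
    have e: "A' = A" "B' = B" using p 1 span_dom_simp span_cod_simp by metis+
    \<comment> \<open>Strictness identifies the apex with \<open>B\<close>, which turns the left leg
      into an arrow from \<open>B\<close> to \<open>A\<close> in \<open>S\<close>.\<close>
    have "iso C f" using B 1(4) e homD[OF 1(4)] unfolding strict_initial_def by blast
    then obtain g where g: "g \<in> hom C B D" "iso C g" using isoE 1(4) e by metis
    then have "s \<cdot> g \<in> S"
      using S_comp[OF S_iso 1(2)] homD[OF g(1)] homD[OF 1(3)] by simp
    then show False using B comp_hom[OF g(1) 1(3)] e by blast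
  qed
  then show "hom (Sect C S) A B = {}" unfolding hom_Sect by blast
qed

end

section \<open>Categories with singleton hom-sets\<close>

text \<open>Every equational axiom compares two arrows of the same hom-set, so the typing laws
  suffice.\<close>

lemma category_of_singleton_homs:
  assumes "\<And>f. f \<in> arr K \<Longrightarrow> cdom K f \<in> obj K \<and> ccod K f \<in> obj K"
    and "\<And>A. A \<in> obj K \<Longrightarrow> cid K A \<in> hom K A A"
    and comp: "\<And>f g X Y Z. \<lbrakk>f \<in> hom K X Y; g \<in> hom K Y Z\<rbrakk> \<Longrightarrow> comp K g f \<in> hom K X Z"
    and uniq: "\<And>f g X Y. \<lbrakk>f \<in> hom K X Y; g \<in> hom K X Y\<rbrakk> \<Longrightarrow> f = g"
  shows "category K"
proof
  show "cdom K f \<in> obj K" "ccod K f \<in> obj K" if "f \<in> arr K" for f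
    using assms(1) that by auto
  show "cid K A \<in> hom K A A" if "A \<in> obj K" for A
    using assms(2) that .
  show "comp K g f \<in> hom K X Z" if "f \<in> hom K X Y" "g \<in> hom K Y Z" for f g X Y Z
    using comp that .
  show "comp K f (cid K X) = f" "comp K (cid K Y) f = f" if f: "f \<in> hom K X Y" for f X Y
  proof -
    have "X \<in> obj K" "Y \<in> obj K" using f assms(1) unfolding hom_def by auto
    then show "comp K f (cid K X) = f" "comp K (cid K Y) f = f"
      using uniq[OF comp[OF assms(2) f] f] uniq[OF comp[OF f assms(2)] f] by blast+
  qed
  show "comp K (comp K h g) f = comp K h (comp K g f)"
    if f: "f \<in> hom K W X" and g: "g \<in> hom K X Y" and h: "h \<in> hom K Y Z" for f g h W X Y Z
    using uniq[OF comp[OF f comp[OF g h]] comp[OF comp[OF f g] h]] .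
qed

lemma category_terminal_cat: "category terminal_cat"
  by (rule category_of_singleton_homs) (auto simp: terminal_cat_def hom_def)

text \<open>The inverse functor picks the object \<open>T\<close>. Naturality, and invertibility of
  every arrow, are again equations between parallel arrows.\<close>

lemma equivalent_terminal_cat:
  assumes K: "category K" and T: "T \<in> obj K"
    and uniq: "\<And>A B. \<lbrakk>A \<in> obj K; B \<in> obj K\<rbrakk> \<Longrightarrow> \<exists>!f. f \<in> hom K A B"
  shows "equivalent_cats K terminal_cat"
proof -
  interpret category K by (rule K)
  have uniq': "f = g" if "f \<in> hom K A B" "g \<in> hom K A B" for f g A B
    using that uniq homD by blast
  define \<eta> where "\<eta> = (\<lambda>A. THE f. f \<in> hom K A T)"
  have \<eta>: "\<eta> A \<in> hom K A T" if "A \<in> obj K" for A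
    unfolding \<eta>_def using theI'[OF uniq[OF that T]] .
  have iso: "iso K f" if f: "f \<in> hom K A B" for f A B
  proof -
    obtain g where g: "g \<in> hom K B A" using uniq homD[OF f] by blast
    show ?thesis
      using isoI[OF f g] uniq' comp_hom[OF f g] comp_hom[OF g f] id_hom homD[OF f] by blast
  qed
  have F: "is_functor K terminal_cat (\<lambda>_. ()) (\<lambda>_. ())"
    unfolding is_functor_def terminal_cat_def hom_def by simp
  have G: "is_functor terminal_cat K (\<lambda>_. T) (\<lambda>_. cid K T)"
    unfolding is_functor_def using T id_hom[OF T] comp_id_left[OF id_hom[OF T]] by simp
  have N: "natural_iso K K (\<lambda>A. A) (\<lambda>f. f) (\<lambda>A. T) (\<lambda>f. cid K T) \<eta>"
    unfolding natural_iso_def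
  proof (intro conjI ballI)
    fix f assume f: "f \<in> arr K"
    have h: "\<eta> (cdom K f) \<in> hom K (cdom K f) T" "\<eta> (ccod K f) \<in> hom K (ccod K f) T"
      using \<eta> dom_obj cod_obj f by blast+
    show "comp K (cid K T) (\<eta> (cdom K f)) = comp K (\<eta> (ccod K f)) f"
      using uniq' comp_hom[OF h(1) id_hom[OF T]] comp_hom[OF arr_hom[OF f] h(2)] by blast
  qed (use \<eta> iso in blast)+
  have "natural_iso terminal_cat terminal_cat (\<lambda>B. ()) (\<lambda>g. ()) (\<lambda>B. B) (\<lambda>g. g) (\<lambda>_. ())"
    unfolding natural_iso_def iso_def terminal_cat_def hom_def by simp
  then show ?thesis
    unfolding equivalent_cats_def using K category_terminal_cat F G N by fast
qed


theorem theorem2: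
  fixes C :: "('o, 'm) cat" and S :: "'m set" and one :: 'o
  assumes "category C" and "stable_class C S"
    and "terminal_obj C one"
    and "strictly_connected C"
    and "\<And>A t. \<lbrakk>A \<in> obj C; \<not> strict_initial C A; t \<in> hom C A one\<rbrakk> \<Longrightarrow> t \<in> S"
  shows "(\<forall>A \<in> obj C. \<forall>B \<in> obj C.
            if strict_initial C B \<and> hom C B A \<inter> S = {}
            then hom (Sect C S) A B = {}
            else card (hom (Sect C S) A B) \<in> {1, 2})
       \<and> ((\<nexists>Z. strict_initial C Z) \<longrightarrow>
            (\<forall>A \<in> obj C. \<forall>B \<in> obj C. card (hom (Sect C S) A B) = 1) \<and>
            equivalent_cats (Sect C S) terminal_cat)"
proof -
  interpret stable_class C S by (rule assms(2))
  interpret strictly_connected_class C S one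
    by unfold_locales (use assms(3-5) in auto)
  have pos: "card (hom (Sect C S) A B) \<ge> 1"
    if "A \<in> obj C" "B \<in> obj C" "\<not> (strict_initial C B \<and> hom C B A \<inter> S = {})" for A B
    using that hom_Sect_empty_iff card_hom_Sect(1) card_gt_0_iff
    by (metis One_nat_def Suc_leI)
  have "if strict_initial C B \<and> hom C B A \<inter> S = {}
      then hom (Sect C S) A B = {} else card (hom (Sect C S) A B) \<in> {1, 2}"
    if AB: "A \<in> obj C" "B \<in> obj C" for A B
  proof (cases "strict_initial C B \<and> hom C B A \<inter> S = {}")
    case True
    then show ?thesis using hom_Sect_empty_iff[OF AB] by simp
  next
    case False
    then show ?thesis using pos[OF AB] card_hom_Sect(2)[of A B] by auto
  qed
  moreover have "(\<forall>A \<in> obj C. \<forall>B \<in> obj C. card (hom (Sect C S) A B) = 1) \<and>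
      equivalent_cats (Sect C S) terminal_cat" if no: "\<nexists>Z. strict_initial C Z"
  proof -
    have one: "card (hom (Sect C S) A B) = 1" if "A \<in> obj C" "B \<in> obj C" for A B
      using pos[OF that] card_hom_Sect(3)[OF no, of A B] no by auto
    then have ex1: "\<exists>!F. F \<in> hom (Sect C S) A B" if "A \<in> obj C" "B \<in> obj C" for A B
      using that by (metis card_1_singletonE singleton_iff)
    \<comment> \<open>Uniqueness of arrows is required for arbitrary ends, whereas
      \<open>ex1\<close> speaks of objects only; an inhabited hom-set has objects as ends.\<close>
    have "A \<in> obj C" "B \<in> obj C" if "F \<in> hom (Sect C S) A B" for F A B
      using that Sect_structure(1)[of F] obj_Sect unfolding hom_def by auto
    then have "category (Sect C S)"
      using Sect_structure ex1 by (intro category_of_singleton_homs) blast+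
    then have "equivalent_cats (Sect C S) terminal_cat"
      using equivalent_terminal_cat[of "Sect C S" one] ex1 terminal obj_Sect
      unfolding terminal_obj_def by simp
    then show ?thesis using one by blast
  qed
  ultimately show ?thesis by blast
qed

end
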